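(* Let $d_1,d_2,d_3,J,K$ be positive integers with $J\le d_1$, $K\le d_3$, and $T$ a positive integer. Let $\mathcal Y=\mathcal T^*+\mathcal E\in\mathbb R^{d_1\times d_2\times d_3}$, where $\mathcal T^*=U^*\times_1V^*\times_3\mathcal W^*$ with $U^*\in\mathbb O_{d_1,J}$, $V^*\in\mathbb O_{d_3,K}$, $\mathcal W^*\in\mathbb R^{J\times d_2\times K}$, and $\mathcal E$ is arbitrary. Let $\widehat{\mathcal T}$ be the output of HardTTh applied to $\mathcal Y$ with ranks $(J,K)$ and $T$ iterations. Suppose $$\sigma_J(\mathtt m_1(\mathcal T^* ))\ge24\|\mathtt m_1(\mathcal E)\|\quad\text{and}\quad\sigma_K(\mathtt m_3(\mathcal T^* ))\ge24\sup_{U\in\mathbb R^{d_1\times J},\|U\|\le1}\|\mathtt m_3(\mathcal E)(U\otimes I_{d_2})\|.$$ Put $\alpha_U=\|\mathtt m_1((V^* )^\top\times_3\mathcal E)\|$, $\beta_U=\sup_{V\in\mathbb R^{d_3\times K},\|V\|\le1}\|\mathtt m_1(V^\top\times_3\mathcal E)\|$, $\alpha_V=\|\mathtt m_3((U^* )^\top\times_1\mathcal E)\|$, $\beta_V=\sup_{U\in\mathbb R^{d_1\times J},\|U\|\le1}\|\mathtt m_3(U^\top\times_1\mathcal E)\|$. Then $$\|\widehat{\mathcal T}-\mathcal T^*\|_{\rm F}\le\sup_{U\in\mathbb O_{d_1,J},V\in\mathbb O_{d_3,K}}\|U^\top\times_1V^\top\times_3\mathcal E\|_{\rm F}+4\sqrt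 K\alpha_V+4\sqrt J\alpha_U+\diamondsuit_2+r_T,$$ where $$\diamondsuit_2=48\Big(\frac{\sqrt K\beta_V\alpha_U}{\sigma_J(\mathtt m_1(\mathcal T^* ))}+\frac{\sqrt J\beta_U\alpha_V}{\sigma_K(\mathtt m_3(\mathcal T^* ))}\Big),\qquad r_T=3(\sqrt J+\sqrt K)\Big(\frac{64\beta_V\beta_U}{\sigma_J(\mathtt m_1(\mathcal T^* ))\sigma_K(\mathtt m_3(\mathcal T^* ))}\Big)^T\|\mathtt m_1(\mathcal E)\|.$$
   Context: Notation: $\|M\|$ is the spectral norm, $\|\cdot\|_{\rm F}$ the Frobenius norm (for tensors: Euclidean norm of all entries), $\sigma_k(M)$ the $k$-th largest singular value, $I_m$ the identity of size $m$, $\otimes$ the Kronecker product. $\mathbb O_{a,b}$ is the set of $a\times b$ real matrices with orthonormal columns. Mode products: for $\mathcal T\in\mathbb R^{n_1\times n_2\times n_3}$ and $M\in\mathbb R^{m\times n_i}$, $M\times_i\mathcal T$ replaces the $i$-th index: $(M\times_1\mathcal T)_{abc}=\sum_{a'}M_{aa'}\mathcal T_{a'bc}$, $(M\times_3\mathcal T)_{abc}=\sum_{c'}M_{cc'}\mathcal T_{abc'}$; $A\times_1B\times_3\mathcal T$ means $A\times_1(B\times_3\mathcal T)$. Unfoldings: for $\mathcal T\in\mathbb R^{n_1\times n_2\times n_3}$, $\mathtt m_1(\mathcal T)\in\mathbb R^{n_1\times n_2n_3}$ with $\mathtt m_1(\mathcal T)_{a,(b-1)n_3+c}=\mathcal T_{abc}$,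 and $\mathtt m_3(\mathcal T)\in\mathbb R^{n_3\times n_1n_2}$ with $\mathtt m_3(\mathcal T)_{c,(a-1)n_2+b}=\mathcal T_{abc}$. HardTTh (input $\mathcal Y\in\mathbb R^{d_1\times d_2\times d_3}$, ranks $(J,K)$, $T$): let $\widehat U_0\in\mathbb O_{d_1,J}$ consist of $J$ leading left singular vectors of $\mathtt m_1(\mathcal Y)$ and $\widehat V_0\in\mathbb O_{d_3,K}$ of $K$ leading left singular vectors of $\mathtt m_3(\widehat U_0^\top\times_1\mathcal Y)$; for $t=1,\dots,T$, let $\widehat U_t$ consist of $J$ leading left singular vectors of $\mathtt m_1(\widehat V_{t-1}^\top\times_3\mathcal Y)$ and $\widehat V_t$ of $K$ leading left singular vectors of $\mathtt m_3(\widehat U_t^\top\times_1\mathcal Y)$. Set $\widehat U=\widehat U_T$, $\widehat V=\widehat V_T$, $\widehat{\mathcal W}=\widehat U^\top\times_1\widehat V^\top\times_3\mathcal Y$, output $\widehat{\mathcal T}=\widehat U\times_1\widehat V\times_3\widehat{\mathcal W}$. *)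

theory Defs
  imports "HOL-Analysis.Analysis"
begin

text \<open>Third-order tensors of size d1 x d2 x d3, indexed by finite types
  'a, 'b, 'c (with CARD = d1, d2, d3); entry (a,b,c) is T$a$b$c.
  Matrices of size m x n are real^'n^'m (entry M$i$j).\<close>

type_synonym ('a,'b,'c) tensor = "real^'c^'b^'a"

definition mode1 :: "real^'a^'m \<Rightarrow> ('a::finite,'b::finite,'c::finite) tensor \<Rightarrow> ('m::finite,'b,'c) tensor" where
  "mode1 M T = (\<chi> a b c. \<Sum>a'\<in>UNIV. M$a$a' * T$a'$b$c)"

definition mode3 :: "real^'c^'m \<Rightarrow> ('a::finite,'b::finite,'c::finite) tensor \<Rightarrow> ('a,'b,'m::finite) tensor" where
  "mode3 M T = (\<chi> a b c. \<Sum>c'\<in>UNIV. M$c$c' * T$a$b$c')"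

text \<open>Unfoldings; the column index (b,c) of m1 corresponds to (b-1)n3+c,
  the column index (a,b) of m3 corresponds to (a-1)n2+b.\<close>
definition unfold1 :: "('a::finite,'b::finite,'c::finite) tensor \<Rightarrow> real^('b \<times> 'c)^'a" where
  "unfold1 T = (\<chi> a p. T$a$(fst p)$(snd p))"

definition unfold3 :: "('a::finite,'b::finite,'c::finite) tensor \<Rightarrow> real^('a \<times> 'b)^'c" where
  "unfold3 T = (\<chi> c p. T$(fst p)$(snd p)$c)"

definition kron :: "real^'q^'p \<Rightarrow> real^'s^'r \<Rightarrow> real^('q::finite \<times> 's::finite)^('p::finite \<times> 'r::finite)" where
  "kron A B = (\<chi> i j. A$(fst i)$(fst j) * B$(snd i)$(snd j))"

definition spec_norm :: "real^'n::finite^'m::finite \<Rightarrow> real" where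
  "spec_norm M = onorm (\<lambda>x. M *v x)"

definition tfro :: "('a::finite,'b::finite,'c::finite) tensor \<Rightarrow> real" where
  "tfro T = sqrt (\<Sum>a\<in>UNIV. \<Sum>b\<in>UNIV. \<Sum>c\<in>UNIV. (T$a$b$c)^2)"

definition orth_cols :: "(real^'n::finite^'m::finite) set" where
  "orth_cols = {U. transpose U ** U = mat 1}"

definition outer :: "real^'m \<Rightarrow> real^'n \<Rightarrow> real^'n^'m" where
  "outer x y = (\<chi> i j. x$i * y$j)"

definition is_svd :: "real^'n::finite^'m::finite \<Rightarrow> (nat \<Rightarrow> real) \<Rightarrow> (nat \<Rightarrow> real^'m) \<Rightarrow> (nat \<Rightarrow> real^'n) \<Rightarrow> bool" where
  "is_svd M s u v \<longleftrightarrow>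
     (\<forall>i<CARD('m). \<forall>j<CARD('m). u i \<bullet> u j = (if i = j then 1 else 0)) \<and>
     (\<forall>i<CARD('n). \<forall>j<CARD('n). v i \<bullet> v j = (if i = j then 1 else 0)) \<and>
     (\<forall>i. 0 \<le> s i) \<and> (\<forall>i j. i \<le> j \<longrightarrow> s j \<le> s i) \<and>
     (\<forall>i. min CARD('m) CARD('n) \<le> i \<longrightarrow> s i = 0) \<and>
     M = (\<Sum>i<min CARD('m) CARD('n). s i *\<^sub>R outer (u i) (v i))"

text \<open>k-th largest singular value (k >= 1); well defined since singular values are unique.\<close>
definition sing_val :: "real^'n::finite^'m::finite \<Rightarrow> nat \<Rightarrow> real" where
  "sing_val M k = (SOME x. \<exists>s u v. is_svd M s u v \<and> x = s (k - 1))"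

definition lead_left :: "real^'n::finite^'m::finite \<Rightarrow> real^'j::finite^'m \<Rightarrow> bool" where
  "lead_left M U \<longleftrightarrow> (\<exists>s u v f. is_svd M s u v \<and> bij_betw f (UNIV::'j set) {..<CARD('j)} \<and>
      (\<forall>p q. U$p$q = (u (f q))$p))"

text \<open>HardTTh: Uh, Vh are the iterates (any valid choice of singular vectors).\<close>
definition hardtth_iter :: "('a::finite,'b::finite,'c::finite) tensor \<Rightarrow> nat \<Rightarrow>
    (nat \<Rightarrow> real^'j::finite^'a) \<Rightarrow> (nat \<Rightarrow> real^'k::finite^'c) \<Rightarrow> bool" where
  "hardtth_iter Y T Uh Vh \<longleftrightarrow>
     lead_left (unfold1 Y) (Uh 0) \<and>
     lead_left (unfold3 (mode1 (transpose (Uh 0)) Y)) (Vh 0) \<and>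
     (\<forall>t. 1 \<le> t \<and> t \<le> T \<longrightarrow>
        lead_left (unfold1 (mode3 (transpose (Vh (t - 1))) Y)) (Uh t) \<and>
        lead_left (unfold3 (mode1 (transpose (Uh t)) Y)) (Vh t))"

definition hardtth_out :: "('a::finite,'b::finite,'c::finite) tensor \<Rightarrow> real^'j::finite^'a \<Rightarrow> real^'k::finite^'c \<Rightarrow> ('a,'b,'c) tensor" where
  "hardtth_out Y U V = mode1 U (mode3 V (mode1 (transpose U) (mode3 (transpose V) Y)))"

end

theory Submission
  imports Defs
begin

text \<open>Let \<open>u\<^sub>t\<close>, \<open>v\<^sub>t\<close> be the sines of the largest principal angles between the
  \<open>t\<close>-th iterates and the true factors. Each half step computes leading singular vectors of a noisy
  low-rank matrix whose noise splits into a part seen by the true factor and a remainder proportional to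
  the previous sine, so \<open>\<sigma>\<^sub>J u\<^sub>t \<le> C (\<alpha>\<^sub>U + \<beta>\<^sub>U v\<^bsub>t-1\<^esub>)\<close> and
  \<open>\<sigma>\<^sub>K v\<^sub>t \<le> C (\<alpha>\<^sub>V + \<beta>\<^sub>V u\<^sub>t)\<close> with \<open>C = 2 / 0.99\<close>; the two together contract geometrically.
  The output error is the compressed noise plus the parts of the true tensor outside the final
  subspaces, and these are controlled in Frobenius norm by compressions of the noise to rank
  \<open>J\<close> or \<open>K\<close>.\<close>

section \<open>Matrix norms and orthonormal columns\<close>

text \<open>Neither perturbation bound for a half step assumes a spectral gap. Singular values enter
  only when a sine is obtained by division, so the terms in \<open>aU\<close> and \<open>aV\<close>
  alone, which come from the Frobenius bound, carry no ratio. The constants: noise below 1/24 of the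
  singular values keeps every sine at most 1/10, and since 0.99^2 + 0.1^2 < 1, compressing the true
  tensor by an iterate costs at most a factor 99/100. The numbers 203/100 and 253/100 round up
  2/0.99 and (5/2)/0.99, and 5/2 rounds up 1 + sqrt 2. One full round contracts by at most
  2.03^2/24^2 < 0.0072, so 101/100 covers the geometric series, and the 64 of the statement leaves
  ample room above 2.03^2. If one of the two singular values vanishes, no sine can be bounded. The
  hypotheses then force \<open>E = 0\<close>, and the gap-free Frobenius bound with zero noise gives
  exact recovery.\<close>

declare transpose_matrix_vector [simp del]

lemma spec_norm_vec: "norm (M *v x) \<le> spec_norm M * norm x"
  unfolding spec_norm_def by (rule onorm) (rule matrix_vector_mul_bounded_linear)

lemma spec_norm_le: "(\<And>x. norm (M *v x) \<le> b * norm x) \<Longrightarrow> spec_norm M \<le> b"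
  unfolding spec_norm_def by (rule onorm_le)

lemma spec_norm_nonneg: "0 \<le> spec_norm M"
  unfolding spec_norm_def by (rule onorm_pos_le) (rule matrix_vector_mul_bounded_linear)

lemma inner_matrix_vec: "x \<bullet> (M *v y) = (transpose M *v x) \<bullet> y"
  for M :: "real^'n::finite^'m::finite"
  by (metis dot_lmul_matrix transpose_matrix_vector)

lemma spec_norm_transpose_le: "spec_norm (transpose M) \<le> spec_norm M"
  for M :: "real^'n::finite^'m::finite"
proof (rule spec_norm_le)
  fix x :: "real^'m"
  let ?w = "transpose M *v x"
  have "norm ?w ^ 2 = x \<bullet> (M *v ?w)"
    by (simp only: inner_matrix_vec[of x M ?w] power2_norm_eq_inner)
  also have "\<dots> \<le> norm x * (spec_norm M * norm ?w)"
    by (meson Cauchy_Schwarz_ineq2 abs_le_D1 mult_left_mono norm_ge_zero order_trans spec_norm_vec)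
  finally have "norm ?w * norm ?w \<le> (spec_norm M * norm x) * norm ?w"
    by (simp add: power2_eq_square mult_ac)
  then show "norm ?w \<le> spec_norm M * norm x"
    by (metis less_eq_real_def mult_nonneg_nonneg mult_right_le_imp_le norm_ge_zero spec_norm_nonneg zero_less_norm_iff norm_zero)
qed

lemma spec_norm_transpose: "spec_norm (transpose M) = spec_norm M"
  for M :: "real^'n::finite^'m::finite"
  by (metis antisym spec_norm_transpose_le transpose_transpose)

lemma matrix_diff_ldistrib: "A ** (B - C) = A ** B - A ** C" for A :: "real^'n::finite^'m::finite"
  by (simp add: matrix_matrix_mult_def vec_eq_iff right_diff_distrib sum_subtractf)

lemma matrix_diff_rdistrib: "(A - B) ** C = A ** C - B ** C" for A :: "real^'n::finite^'m::finite"
  by (simp add: matrix_matrix_mult_def vec_eq_iff left_diff_distrib sum_subtractf)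

lemma matrix_add_rdistrib: "(A + B) ** C = A ** C + B ** C" for A :: "real^'n::finite^'m::finite"
  by (simp add: matrix_matrix_mult_def vec_eq_iff distrib_right sum.distrib)

lemma norm_matrix_sq: "norm M ^ 2 = (\<Sum>i\<in>UNIV. norm (M $ i) ^ 2)"
  for M :: "real^'n::finite^'m::finite"
  by (simp add: power2_norm_eq_inner inner_vec_def[of M])

lemma inner_transpose: "transpose M \<bullet> transpose N = M \<bullet> N"
  for M N :: "real^'n::finite^'m::finite"
  unfolding inner_vec_def transpose_def by (simp, rule sum.swap)

lemma norm_transpose: "norm (transpose M) = norm M"
  for M :: "real^'n::finite^'m::finite"
  by (simp add: norm_eq_sqrt_inner inner_transpose)

lemma matrix_mul_row: "(A ** B) $ i = transpose B *v (A $ i)"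
  for A :: "real^'n::finite^'m::finite"
  by (simp add: matrix_matrix_mult_def matrix_vector_mult_def transpose_def vec_eq_iff mult.commute)

lemma norm_matrix_mul_sq:
  "norm (A ** B) ^ 2 = (\<Sum>i\<in>UNIV. norm (transpose B *v (A $ i)) ^ 2)"
  for A :: "real^'n::finite^'m::finite"
  by (simp add: norm_matrix_sq matrix_mul_row)

lemma norm_matrix_mul_le: "norm (A ** B) \<le> spec_norm A * norm B"
  for A :: "real^'n::finite^'m::finite" and B :: "real^'p::finite^'n"
proof -
  have "norm (A ** B) ^ 2 = norm (transpose B ** transpose A) ^ 2"
    by (metis matrix_transpose_mul norm_transpose)
  also have "\<dots> = (\<Sum>i\<in>UNIV. norm (A *v (transpose B $ i)) ^ 2)"
    by (simp add: norm_matrix_mul_sq transpose_transpose)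
  also have "\<dots> \<le> (\<Sum>i\<in>UNIV. (spec_norm A * norm (transpose B $ i)) ^ 2)"
    by (intro sum_mono power_mono spec_norm_vec norm_ge_zero)
  also have "\<dots> = (spec_norm A * norm (transpose B)) ^ 2"
    by (simp add: norm_matrix_sq[of "transpose B"] power_mult_distrib sum_distrib_left)
  finally show ?thesis
    by (simp add: norm_transpose spec_norm_nonneg)
qed

lemma spec_norm_mul: "spec_norm (A ** B) \<le> spec_norm A * spec_norm B"
  for A :: "real^'n::finite^'m::finite" and B :: "real^'p::finite^'n"
proof (rule spec_norm_le)
  fix x
  have "norm ((A ** B) *v x) \<le> spec_norm A * norm (B *v x)"
    by (metis matrix_vector_mul_assoc spec_norm_vec)
  also have "\<dots> \<le> spec_norm A * (spec_norm B * norm x)"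
    by (intro mult_left_mono spec_norm_vec spec_norm_nonneg)
  finally show "norm ((A ** B) *v x) \<le> spec_norm A * spec_norm B * norm x" by simp
qed

lemma inner_mul_left: "(C ** X) \<bullet> Y = X \<bullet> (transpose C ** Y)"
  for C :: "real^'n::finite^'m::finite" and X :: "real^'p::finite^'n"
proof -
  have "(C ** X) \<bullet> Y = (\<Sum>i\<in>UNIV. \<Sum>l\<in>UNIV. \<Sum>k\<in>UNIV. C$i$k * X$k$l * Y$i$l)"
    by (simp add: inner_vec_def matrix_matrix_mult_def sum_distrib_right)
  also have "\<dots> = (\<Sum>i\<in>UNIV. \<Sum>k\<in>UNIV. \<Sum>l\<in>UNIV. C$i$k * X$k$l * Y$i$l)"
    by (intro sum.cong refl sum.swap)
  also have "\<dots> = (\<Sum>k\<in>UNIV. \<Sum>i\<in>UNIV. \<Sum>l\<in>UNIV. C$i$k * X$k$l * Y$i$l)"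
    by (rule sum.swap)
  also have "\<dots> = (\<Sum>k\<in>UNIV. \<Sum>l\<in>UNIV. \<Sum>i\<in>UNIV. C$i$k * X$k$l * Y$i$l)"
    by (intro sum.cong refl sum.swap)
  also have "\<dots> = X \<bullet> (transpose C ** Y)"
    by (simp add: inner_vec_def matrix_matrix_mult_def transpose_def sum_distrib_left mult_ac)
  finally show ?thesis .
qed

lemma norm_row_le_spec: "norm (A $ i) \<le> spec_norm A"
  for A :: "real^'n::finite^'m::finite"
proof -
  have "A $ i = transpose A *v axis i 1"
    by (simp add: matrix_vector_mult_def transpose_def axis_def vec_eq_iff if_distrib cong: if_cong)
  then show ?thesis
    using spec_norm_vec[of "transpose A" "axis i 1"] by (simp add: spec_norm_transpose)
qed

text \<open>A row is never longer than the spectral norm, and there are \<open>CARD('m)\<close>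
  rows. All factors sqrt J and sqrt K of the final bound originate here.\<close>

lemma norm_mul_le_sqrt_card:
  "norm (A ** B) \<le> sqrt (real CARD('m)) * (spec_norm A * spec_norm B)"
  for A :: "real^'n::finite^'m::finite" and B :: "real^'p::finite^'n"
proof -
  have "norm (A ** B) ^ 2 \<le> (\<Sum>i\<in>(UNIV::'m set). (spec_norm A * spec_norm B) ^ 2)"
    unfolding norm_matrix_sq
    by (intro sum_mono power_mono norm_ge_zero order_trans[OF norm_row_le_spec spec_norm_mul])
  also have "\<dots> = (sqrt (real CARD('m)) * (spec_norm A * spec_norm B)) ^ 2"
    by (simp add: power_mult_distrib)
  finally show ?thesis
    by (rule power2_le_imp_le) (simp add: spec_norm_nonneg)
qed

section \<open>Matrices with orthonormal columns\<close>

lemma orth_cols_iff: "U \<in> orth_cols \<longleftrightarrow> (\<forall>p q. column p U \<bullet> column q U = (if p = q then 1 else 0))"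
  by (simp add: orth_cols_def vec_eq_iff matrix_matrix_mult_def transpose_def mat_def inner_vec_def column_def)

lemma orth_cols_inner: "U \<in> orth_cols \<Longrightarrow> (U *v x) \<bullet> (U *v y) = x \<bullet> y"
  for U :: "real^'n::finite^'m::finite"
  by (simp add: inner_matrix_vec[of "U *v x" U y] matrix_vector_mul_assoc orth_cols_def)

lemma orth_cols_norm: "U \<in> orth_cols \<Longrightarrow> norm (U *v x) = norm x"
  for U :: "real^'n::finite^'m::finite"
  by (simp add: norm_eq_sqrt_inner orth_cols_inner)

lemma orth_cols_spec: "U \<in> orth_cols \<Longrightarrow> spec_norm U \<le> 1"
  by (rule spec_norm_le) (simp add: orth_cols_norm)

lemma orth_cols_left: "U \<in> orth_cols \<Longrightarrow> transpose U *v (U *v x) = x"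
  for U :: "real^'n::finite^'m::finite"
  by (simp add: matrix_vector_mul_assoc orth_cols_def)

lemma orth_cols_norm_mul: "U \<in> orth_cols \<Longrightarrow> norm (U ** X) = norm X"
  for U :: "real^'n::finite^'m::finite" and X :: "real^'p::finite^'n"
  by (simp add: norm_eq_sqrt_inner inner_mul_left matrix_mul_assoc orth_cols_def)

lemma orth_proj_pyth:
  fixes U :: "real^'n::finite^'m::finite"
  assumes "U \<in> orth_cols"
  shows "norm (x - U *v (transpose U *v x)) ^ 2 = norm x ^ 2 - norm (transpose U *v x) ^ 2"
proof -
  have "x \<bullet> (U *v (transpose U *v x)) = (transpose U *v x) \<bullet> (transpose U *v x)"
    by (rule inner_matrix_vec)
  moreover have "(U *v (transpose U *v x)) \<bullet> (U *v (transpose U *v x)) = (transpose U *v x) \<bullet> (transpose U *v x)"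
    using assms by (rule orth_cols_inner)
  ultimately show ?thesis
    by (simp add: power2_norm_eq_inner inner_diff_left inner_diff_right inner_commute)
qed

section \<open>Singular value decomposition\<close>

abbreviation orthonormal_upto :: "nat \<Rightarrow> (nat \<Rightarrow> 'a::real_inner) \<Rightarrow> bool" where
  "orthonormal_upto k u \<equiv> \<forall>i<k. \<forall>j<k. u i \<bullet> u j = (if i = j then 1 else 0)"

lemma exists_unit_orthogonal:
  fixes u :: "nat \<Rightarrow> real^'m::finite"
  assumes "k < CARD('m)"
  shows "\<exists>x. norm x = 1 \<and> (\<forall>j<k. u j \<bullet> x = 0)"
proof -
  have "dim (u ` {..<k}) \<le> card (u ` {..<k})" by (simp add: dim_le_card')
  also have "\<dots> \<le> k" by (metis card_image_le card_lessThan finite_lessThan)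
  finally have "dim (u ` {..<k}) < DIM(real^'m)" using assms by simp
  then obtain x where x: "x \<noteq> 0" "\<And>y. y \<in> span (u ` {..<k}) \<Longrightarrow> orthogonal x y"
    by (rule orthogonal_to_subspace_exists) blast
  have "u j \<bullet> x = 0" if "j < k" for j
    using x(2)[of "u j"] that by (simp add: orthogonal_def span_base inner_commute)
  then have "\<forall>j<k. u j \<bullet> (x /\<^sub>R norm x) = 0" by simp
  then show ?thesis using x(1) by (intro exI[of _ "x /\<^sub>R norm x"]) simp
qed

lemma orthonormal_upto_Suc:
  assumes "orthonormal_upto k u" "norm x = 1" "\<forall>j<k. u j \<bullet> x = 0"
  shows "orthonormal_upto (Suc k) (u(k := x))"
proof -
  have "\<forall>j<k. x \<bullet> u j = 0" using assms(3) by (simp add: inner_commute)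
  then show ?thesis using assms by (auto simp: less_Suc_eq norm_eq_1)
qed

text \<open>\<open>is_svd\<close> asks for full orthonormal bases on both sides, while only min(m,
  n) singular pairs are constructed; this supplies the remaining vectors.\<close>

lemma orthonormal_extend:
  fixes u :: "nat \<Rightarrow> real^'m::finite"
  assumes "orthonormal_upto k u" "k \<le> CARD('m)"
  shows "\<exists>u'. (\<forall>i<k. u' i = u i) \<and> orthonormal_upto CARD('m) u'"
proof -
  have "p \<le> CARD('m) \<longrightarrow> (\<exists>u'. (\<forall>i<k. u' i = u i) \<and> orthonormal_upto p u')" if "k \<le> p" for p
    using that
  proof (induction p rule: dec_induct)
    case base
    show ?case using assms(1) by blast
  next
    case (step p)
    show ?case
    proof
      assume p: "Suc p \<le> CARD('m)"
      then obtain u' where u': "\<forall>i<k. u' i = u i" "orthonormal_upto p u'"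
        using step.IH by auto
      obtain x where "norm x = 1" "\<forall>j<p. u' j \<bullet> x = 0"
        using exists_unit_orthogonal[of p u'] p by auto
      then have "orthonormal_upto (Suc p) (u'(p := x))"
        using u'(2) by (rule_tac orthonormal_upto_Suc)
      moreover have "\<forall>i<k. (u'(p := x)) i = u i" using u'(1) step.hyps by auto
      ultimately show "\<exists>u'. (\<forall>i<k. u' i = u i) \<and> orthonormal_upto (Suc p) u'" by blast
    qed
  qed
  then show ?thesis using assms(2) by blast
qed

lemma parseval:
  fixes u :: "nat \<Rightarrow> real^'m::finite"
  assumes "orthonormal_upto CARD('m) u"
  shows "(\<Sum>i<CARD('m). (u i \<bullet> x) * (u i \<bullet> y)) = x \<bullet> y"
proof -
  obtain g where g: "bij_betw g (UNIV::'m set) {..<CARD('m)}"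
    using ex_bij_betw_finite_nat[of "UNIV::'m set"] by (auto simp: atLeast0LessThan)
  define B :: "real^'m^'m" where "B = (\<chi> p. u (g p))"
  have lt: "g p < CARD('m)" for p using g by (auto simp: bij_betw_def)
  have inj: "g p = g q \<longleftrightarrow> p = q" for p q using g by (auto simp: bij_betw_def inj_on_def)
  have "B ** transpose B = mat 1"
    using assms lt inj
    by (simp add: vec_eq_iff matrix_matrix_mult_def transpose_def mat_def B_def inner_vec_def)
  \<comment> \<open>Orthonormal rows give only \<open>B ** transpose B = mat 1\<close>; as
    \<open>B\<close> is square, the other order follows, and that is completeness of the
    family.\<close>
  then have BB: "transpose B ** B = mat 1" by (simp add: matrix_left_right_inverse)
  have "x \<bullet> y = (B *v x) \<bullet> (B *v y)"
    by (simp add: inner_matrix_vec[of "B *v x"] matrix_vector_mul_assoc BB)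
  also have "\<dots> = (\<Sum>p\<in>UNIV. (u (g p) \<bullet> x) * (u (g p) \<bullet> y))"
    unfolding inner_vec_def[of "B *v x"] by (simp add: matrix_vector_mul_component B_def)
  also have "\<dots> = (\<Sum>i<CARD('m). (u i \<bullet> x) * (u i \<bullet> y))"
    using sum.reindex_bij_betw[OF g] .
  finally show ?thesis by simp
qed

lemma outer_vec: "outer x y *v z = (y \<bullet> z) *\<^sub>R x"
  by (simp add: outer_def matrix_vector_mult_def vec_eq_iff inner_vec_def sum_distrib_left mult_ac)

lemma sum_outer_vec:
  "(\<Sum>i<r. s i *\<^sub>R outer (u i) (v i)) *v x = (\<Sum>i<r. (s i * (v i \<bullet> x)) *\<^sub>R u i)"
  for r :: nat
  by (induction r) (simp_all add: matrix_vector_mult_add_rdistrib outer_vec flip: scaleR_matrix_vector_assoc)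

lemma is_svd_inner:
  fixes M :: "real^'n::finite^'m::finite"
  assumes "is_svd M s u v"
  shows "y \<bullet> (M *v x) = (\<Sum>i<min CARD('m) CARD('n). s i * (u i \<bullet> y) * (v i \<bullet> x))"
proof -
  have M: "M = (\<Sum>i<min CARD('m) CARD('n). s i *\<^sub>R outer (u i) (v i))"
    using assms unfolding is_svd_def by blast
  show ?thesis
    by (subst M) (simp add: sum_outer_vec inner_sum_right inner_commute mult_ac)
qed

text \<open>Maximality of \<open>v\<close> for the Rayleigh quotient gives the first-order condition
  \<open>M\<^sup>T M v = \<sigma>\<^sup>2 v\<close> on the subspace.\<close>
lemma rayleigh_stationary:
  fixes M :: "real^'n::finite^'m::finite"
  assumes max: "\<And>x. x \<in> X \<Longrightarrow> norm (M *v x) \<le> \<sigma> * norm x" and X: "subspace X"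
    and v: "v \<in> X" "norm (M *v v) = \<sigma> * norm v" and x: "x \<in> X"
  shows "(M *v v) \<bullet> (M *v x) = \<sigma>\<^sup>2 * (v \<bullet> x)"
proof -
  define b where "b = \<sigma>\<^sup>2 * (v \<bullet> x) - (M *v v) \<bullet> (M *v x)"
  define q where "q = \<sigma>\<^sup>2 * (x \<bullet> x) - (M *v x) \<bullet> (M *v x)"
  have v0: "\<sigma>\<^sup>2 * (v \<bullet> v) = (M *v v) \<bullet> (M *v v)"
    using v(2) by (simp add: power_mult_distrib flip: power2_norm_eq_inner)
  have nonneg: "0 \<le> 2 * t * b + t\<^sup>2 * q" for t
  proof -
    have "v + t *\<^sub>R x \<in> X" using X v(1) x by (simp add: subspace_add subspace_scale)
    then have "(norm (M *v (v + t *\<^sub>R x)))\<^sup>2 \<le> \<sigma>\<^sup>2 * (norm (v + t *\<^sub>R x))\<^sup>2"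
      using max by (metis norm_ge_zero power_mono power_mult_distrib)
    then have "(M *v v + t *\<^sub>R (M *v x)) \<bullet> (M *v v + t *\<^sub>R (M *v x)) \<le> \<sigma>\<^sup>2 * ((v + t *\<^sub>R x) \<bullet> (v + t *\<^sub>R x))"
      by (simp add: power2_norm_eq_inner matrix_vector_right_distrib matrix_vector_mult_scaleR)
    then have "(M *v v) \<bullet> (M *v v) + 2 * t * ((M *v v) \<bullet> (M *v x)) + t\<^sup>2 * ((M *v x) \<bullet> (M *v x))
        \<le> \<sigma>\<^sup>2 * (v \<bullet> v + 2 * t * (v \<bullet> x) + t\<^sup>2 * (x \<bullet> x))"
      by (simp add: inner_add_left inner_add_right inner_commute
          power2_eq_square algebra_simps)
    then show ?thesis using v0 by (simp add: b_def q_def algebra_simps)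
  qed
  have "b = 0"
  proof (rule ccontr)
    assume b: "b \<noteq> 0"
    \<comment> \<open>At t = -b/c the quadratic equals (b^2/c)(q/c - 2), which is negative as soon
      as c is positive and exceeds q.\<close>
    define c where "c = \<bar>q\<bar> + 1"
    have c: "0 < c" "q < c" by (auto simp: c_def)
    have "2 * (- b / c) * b + (- b / c)\<^sup>2 * q = b\<^sup>2 / c * (q / c - 2)"
      using c by (simp add: field_simps power2_eq_square)
    moreover have "q / c - 2 < 0" using c by (simp add: field_simps)
    moreover have "0 < b\<^sup>2 / c" using b c by simp
    ultimately have "2 * (- b / c) * b + (- b / c)\<^sup>2 * q < 0"
      using mult_pos_neg[of "b\<^sup>2 / c" "q / c - 2"] by linarith
    then show False using nonneg[of "- b / c"] by linarith
  qed
  then show ?thesis by (simp add: b_def)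
qed

text \<open>Deflation: the next right vector maximises the length of its image over unit vectors
  orthogonal to the earlier ones. The last conjunct is the invariant that makes each new singular
  value at most the earlier ones.\<close>

lemma partial_svd:
  fixes M :: "real^'n::finite^'m::finite"
  assumes "k \<le> min CARD('m) CARD('n)"
  shows "\<exists>s u v. orthonormal_upto k u \<and> orthonormal_upto k v
     \<and> (\<forall>i<k. 0 \<le> s i) \<and> (\<forall>i j. i \<le> j \<and> j < k \<longrightarrow> s j \<le> s i)
     \<and> (\<forall>i<k. M *v v i = s i *\<^sub>R u i) \<and> (\<forall>i<k. transpose M *v u i = s i *\<^sub>R v i)
     \<and> (\<forall>i<k. \<forall>x. (\<forall>j<k. v j \<bullet> x = 0) \<longrightarrow> norm (M *v x) \<le> s i * norm x)"
  using assms
proof (induction k)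
  case 0
  show ?case by simp
next
  case (Suc k)
  then obtain s u v where ou: "orthonormal_upto k u" and ov: "orthonormal_upto k v"
    and s0: "\<forall>i<k. 0 \<le> s i" and mono: "\<forall>i j. i \<le> j \<and> j < k \<longrightarrow> s j \<le> s i"
    and Mv: "\<forall>i<k. M *v v i = s i *\<^sub>R u i" and Mu: "\<forall>i<k. transpose M *v u i = s i *\<^sub>R v i"
    and bnd: "\<forall>i<k. \<forall>x. (\<forall>j<k. v j \<bullet> x = 0) \<longrightarrow> norm (M *v x) \<le> s i * norm x"
    by auto
  define X where "X = {x. \<forall>j<k. v j \<bullet> x = 0}"
  have X: "subspace X" by (simp add: X_def subspace_def inner_add_right)
  let ?S = "X \<inter> sphere 0 1"
  have "X = (\<Inter>j\<in>{..<k}. {x. v j \<bullet> x = 0})" by (auto simp: X_def)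
  then have "closed X" by (auto intro!: closed_INT closed_hyperplane)
  then have "compact ?S" by (intro closed_Int_compact compact_sphere)
  moreover have "?S \<noteq> {}"
    using exists_unit_orthogonal[of k v] Suc.prems by (auto simp: X_def)
  moreover have "continuous_on ?S (\<lambda>x. norm (M *v x))"
    by (intro continuous_intros linear_continuous_on matrix_vector_mul_bounded_linear)
  ultimately obtain w where w: "w \<in> ?S" and wmax: "\<forall>x\<in>?S. norm (M *v x) \<le> norm (M *v w)"
    using continuous_attains_sup[of ?S "\<lambda>x. norm (M *v x)"] by blast
  define \<sigma> where "\<sigma> = norm (M *v w)"
  have w1: "norm w = 1" and wX: "w \<in> X" using w by auto
  have max: "norm (M *v x) \<le> \<sigma> * norm x" if "x \<in> X" for x
  proof (cases "x = 0")
    case False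
    then have "x /\<^sub>R norm x \<in> ?S" using that X by (simp add: subspace_scale)
    then have "norm (M *v (x /\<^sub>R norm x)) \<le> \<sigma>" using wmax \<sigma>_def by blast
    then show ?thesis using False
      by (simp add: matrix_vector_mult_scaleR field_simps)
  qed simp
  have stat: "(M *v w) \<bullet> (M *v x) = \<sigma>\<^sup>2 * (w \<bullet> x)" if "x \<in> X" for x
    by (rule rayleigh_stationary[OF max X wX _ that]) (auto simp: w1 \<sigma>_def)
  have Mvw: "(M *v w) \<bullet> u i = 0" if "i < k" for i
    using Mu that wX by (simp add: inner_commute[of "M *v w"] inner_matrix_vec X_def)
  \<comment> \<open>Stationarity of \<open>w\<close> is known on \<open>X\<close> only. Splitting a
    vector into a part in \<open>X\<close> and a combination of earlier \<open>v j\<close> lets the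
    equation for \<open>transpose M\<close> be tested against every vector.\<close>
  have dec: "\<exists>a y. x = y + (\<Sum>j<k. a j *\<^sub>R v j) \<and> y \<in> X" for x
  proof -
    have "v i \<bullet> (x - (\<Sum>j<k. (v j \<bullet> x) *\<^sub>R v j)) = 0" if "i < k" for i
    proof -
      have "v i \<bullet> (\<Sum>j<k. (v j \<bullet> x) *\<^sub>R v j) = (\<Sum>j<k. if j = i then v i \<bullet> x else 0)"
        using ov that by (simp add: inner_sum_right mult_delta_right)
      then show ?thesis using that by (simp add: inner_diff_right)
    qed
    then show ?thesis unfolding X_def
      by (intro exI[of _ "\<lambda>j. v j \<bullet> x"] exI[of _ "x - (\<Sum>j<k. (v j \<bullet> x) *\<^sub>R v j)"]) simp
  qed
  have "\<exists>z. norm z = 1 \<and> (\<forall>j<k. u j \<bullet> z = 0) \<and> M *v w = \<sigma> *\<^sub>R z \<and> transpose M *v z = \<sigma> *\<^sub>R w"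
  proof (cases "\<sigma> = 0")
    case True
    \<comment> \<open>Normalising \<open>M *v w\<close> is impossible here. But \<open>M\<close>
      vanishes on \<open>X\<close>, so any unit vector orthogonal to the earlier left vectors will
      do.\<close>
    obtain z where z: "norm z = 1" "\<forall>j<k. u j \<bullet> z = 0"
      using exists_unit_orthogonal[of k u] Suc.prems by auto
    have "(transpose M *v z) \<bullet> x = 0" for x
    proof -
      obtain a y where x: "x = y + (\<Sum>j<k. a j *\<^sub>R v j)" and y: "y \<in> X" using dec by blast
      have "M *v y = 0" using max[OF y] True by simp
      then have "M *v x = (\<Sum>j<k. a j *\<^sub>R (s j *\<^sub>R u j))"
        using Mv by (simp add: x matrix_vector_right_distrib matrix_vector_mult_scaleR
            linear_sum[OF matrix_vector_mul_linear] o_def)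
      then have "z \<bullet> (M *v x) = 0" using z(2) by (simp add: inner_sum_right inner_commute)
      then show ?thesis by (simp add: inner_matrix_vec)
    qed
    then have "transpose M *v z = 0" by (metis inner_eq_zero_iff)
    then show ?thesis using z True by (intro exI[of _ z]) (simp add: \<sigma>_def)
  next
    case False
    define z where "z = (M *v w) /\<^sub>R \<sigma>"
    have Mw: "M *v w = \<sigma> *\<^sub>R z" using False by (simp add: z_def)
    have "norm z = 1" using False by (simp add: z_def \<sigma>_def)
    moreover have zu: "\<forall>j<k. u j \<bullet> z = 0" using Mvw by (simp add: z_def inner_commute)
    \<comment> \<open>Both sides vanish on the earlier \<open>v j\<close>, so only the component of
      \<open>x\<close> in \<open>X\<close> counts, where \<open>stat\<close> applies.\<close>
    moreover have "(transpose M *v z) \<bullet> x = (\<sigma> *\<^sub>R w) \<bullet> x" for x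
    proof -
      obtain a y where x: "x = y + (\<Sum>j<k. a j *\<^sub>R v j)" and y: "y \<in> X" using dec by blast
      have "z \<bullet> (M *v v j) = 0" if "j < k" for j
        using Mv zu that by (simp add: inner_commute)
      then have "z \<bullet> (M *v x) = z \<bullet> (M *v y)"
        by (simp add: x matrix_vector_right_distrib matrix_vector_mult_scaleR
            linear_sum[OF matrix_vector_mul_linear] o_def inner_add_right inner_sum_right)
      also have "\<dots> = \<sigma> * (w \<bullet> y)"
        using stat[OF y] False by (simp add: z_def power2_eq_square)
      also have "w \<bullet> y = w \<bullet> x"
        using wX by (simp add: x inner_add_right inner_sum_right X_def inner_commute)
      finally show ?thesis by (simp add: inner_matrix_vec)
    qed
    then have "transpose M *v z = \<sigma> *\<^sub>R w" using vector_eq_rdot by blast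
    ultimately show ?thesis using Mw by blast
  qed
  then obtain z where z: "norm z = 1" "\<forall>j<k. u j \<bullet> z = 0" "M *v w = \<sigma> *\<^sub>R z" "transpose M *v z = \<sigma> *\<^sub>R w"
    by blast
  have sw: "\<sigma> \<le> s i" if "i < k" for i
    using bnd that wX w1 by (force simp: \<sigma>_def X_def)
  show ?case
  proof (intro exI conjI)
    show "orthonormal_upto (Suc k) (u(k := z))"
      using ou z(1,2) by (rule orthonormal_upto_Suc)
    show "orthonormal_upto (Suc k) (v(k := w))"
      using ov w1 wX by (intro orthonormal_upto_Suc) (auto simp: X_def)
    show "\<forall>i<Suc k. 0 \<le> (s(k := \<sigma>)) i" using s0 by (auto simp: less_Suc_eq \<sigma>_def)
    show "\<forall>i j. i \<le> j \<and> j < Suc k \<longrightarrow> (s(k := \<sigma>)) j \<le> (s(k := \<sigma>)) i"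
      using mono sw by (auto simp: less_Suc_eq)
    show "\<forall>i<Suc k. M *v (v(k := w)) i = (s(k := \<sigma>)) i *\<^sub>R (u(k := z)) i"
      using Mv z(3) by (auto simp: less_Suc_eq)
    show "\<forall>i<Suc k. transpose M *v (u(k := z)) i = (s(k := \<sigma>)) i *\<^sub>R (v(k := w)) i"
      using Mu z(4) by (auto simp: less_Suc_eq)
    show "\<forall>i<Suc k. \<forall>x. (\<forall>j<Suc k. (v(k := w)) j \<bullet> x = 0) \<longrightarrow> norm (M *v x) \<le> (s(k := \<sigma>)) i * norm x"
    proof (intro allI impI)
      fix i x assume i: "i < Suc k" and x: "\<forall>j<Suc k. (v(k := w)) j \<bullet> x = 0"
      have "v j \<bullet> x = 0" if "j < k" for j
        using x[rule_format, of j] that by simp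
      then have xX: "x \<in> X" by (simp add: X_def)
      show "norm (M *v x) \<le> (s(k := \<sigma>)) i * norm x"
        using i max[OF xX] bnd xX by (auto simp: less_Suc_eq X_def)
    qed
  qed
qed

lemma is_svd_exists: "\<exists>s u v. is_svd M s u v"
  for M :: "real^'n::finite^'m::finite"
proof -
  define r where "r = min CARD('m) CARD('n)"
  obtain s u0 v0 where ou: "orthonormal_upto r u0" and ov: "orthonormal_upto r v0"
    and s0: "\<forall>i<r. 0 \<le> s i" and mono: "\<forall>i j. i \<le> j \<and> j < r \<longrightarrow> s j \<le> s i"
    and Mv0: "\<forall>i<r. M *v v0 i = s i *\<^sub>R u0 i" and Mu0: "\<forall>i<r. transpose M *v u0 i = s i *\<^sub>R v0 i"
    using partial_svd[of r M] by (auto simp: r_def)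
  obtain u where u: "\<forall>i<r. u i = u0 i" "orthonormal_upto CARD('m) u"
    using orthonormal_extend[OF ou] by (auto simp: r_def)
  obtain v where v: "\<forall>i<r. v i = v0 i" "orthonormal_upto CARD('n) v"
    using orthonormal_extend[OF ov] by (auto simp: r_def)
  define s' where "s' i = (if i < r then s i else 0)" for i
  have Mv: "M *v v i = s i *\<^sub>R u i" and Mu: "transpose M *v u i = s i *\<^sub>R v i" if "i < r" for i
    using that u(1) v(1) Mv0 Mu0 by auto
  have "y \<bullet> (M *v x) = (\<Sum>i<r. s i * (u i \<bullet> y) * (v i \<bullet> x))" for x y
  \<comment> \<open>The \<open>r\<close> vectors found are already a complete basis on the smaller
    of the two sides; Parseval is applied on that side.\<close>
  proof (cases "r = CARD('m)")
    case True
    have "y \<bullet> (M *v x) = (\<Sum>i<r. (u i \<bullet> y) * (u i \<bullet> (M *v x)))"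
      using parseval[OF u(2)] True by simp
    then show ?thesis using Mu by (simp add: inner_matrix_vec mult_ac)
  next
    case False
    then have r: "r = CARD('n)" by (auto simp: r_def min_def)
    have "y \<bullet> (M *v x) = (\<Sum>i<r. (v i \<bullet> (transpose M *v y)) * (v i \<bullet> x))"
      unfolding inner_matrix_vec[of y] r using parseval[OF v(2), of "transpose M *v y" x] by simp
    then show ?thesis using Mv by (simp add: inner_matrix_vec transpose_transpose mult_ac)
  qed
  then have "y \<bullet> (M *v x) = y \<bullet> ((\<Sum>i<r. s i *\<^sub>R outer (u i) (v i)) *v x)" for x y
    by (simp add: sum_outer_vec inner_sum_right inner_commute mult_ac)
  then have "M = (\<Sum>i<r. s i *\<^sub>R outer (u i) (v i))"
    unfolding matrix_eq using vector_eq_ldot by blast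
  then have "M = (\<Sum>i<r. s' i *\<^sub>R outer (u i) (v i))" by (simp add: s'_def)
  then have "is_svd M s' u v"
    using u(2) v(2) s0 mono unfolding is_svd_def r_def[symmetric] by (auto simp: s'_def)
  then show ?thesis by blast
qed

lemma is_svd_gram:
  fixes M :: "real^'n::finite^'m::finite"
  assumes svd: "is_svd M s u v"
  shows "(transpose M *v x) \<bullet> (transpose M *v y) = (\<Sum>i<CARD('m). (s i)\<^sup>2 * (u i \<bullet> x) * (u i \<bullet> y))"
proof -
  define r where "r = min CARD('m) CARD('n)"
  have ov: "orthonormal_upto CARD('n) v" and s0: "\<And>i. r \<le> i \<Longrightarrow> s i = 0"
    using svd by (auto simp: is_svd_def r_def)
  have v: "v i \<bullet> (transpose M *v y) = s i * (u i \<bullet> y)" if "i < r" for i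
  proof -
    have "v i \<bullet> (transpose M *v y) = y \<bullet> (M *v v i)"
      by (simp add: inner_matrix_vec[of y] inner_commute)
    also have "\<dots> = (\<Sum>j<r. if j = i then s i * (u i \<bullet> y) else 0)"
      using ov that unfolding is_svd_inner[OF svd] r_def[symmetric]
      by (intro sum.cong) (auto simp: r_def)
    finally show ?thesis using that by simp
  qed
  have "(transpose M *v x) \<bullet> (transpose M *v y) = x \<bullet> (M *v (transpose M *v y))"
    by (simp only: inner_matrix_vec[of x])
  also have "\<dots> = (\<Sum>i<r. (s i)\<^sup>2 * (u i \<bullet> x) * (u i \<bullet> y))"
    unfolding is_svd_inner[OF svd] r_def[symmetric]
    by (intro sum.cong) (simp_all add: v power2_eq_square)
  \<comment> \<open>The singular values vanish from \<open>r\<close> on. Summing over the whole left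
    basis allows a direct comparison with Parseval for \<open>u\<close>.\<close>
  also have "\<dots> = (\<Sum>i<CARD('m). (s i)\<^sup>2 * (u i \<bullet> x) * (u i \<bullet> y))"
    using s0 by (intro sum.mono_neutral_left) (auto simp: r_def)
  finally show ?thesis .
qed

text \<open>Subtract the threshold \<open>s (k - 1)\<close> from all values; since the weights sum
  to \<open>k\<close>, this lowers both sides equally. Then weight 1 is best for the first
  \<open>k\<close> indices and weight 0 for the others.\<close>

lemma sum_weights_le:
  fixes s w :: "nat \<Rightarrow> real"
  assumes "0 < k" "k \<le> m" and s: "\<And>i j. i \<le> j \<Longrightarrow> s j \<le> s i"
    and w: "\<And>i. i < m \<Longrightarrow> 0 \<le> w i" "\<And>i. i < m \<Longrightarrow> w i \<le> 1" "(\<Sum>i<m. w i) = real k"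
  shows "(\<Sum>i<m. s i * w i) \<le> (\<Sum>i<k. s i)"
proof -
  let ?t = "s (k - 1)"
  have "(\<Sum>i<m. (s i - ?t) * w i) \<le> (\<Sum>i<m. if i < k then s i - ?t else 0)"
  proof (rule sum_mono)
    fix i assume i: "i \<in> {..<m}"
    show "(s i - ?t) * w i \<le> (if i < k then s i - ?t else 0)"
    proof (cases "i < k")
      case True
      then have "0 \<le> s i - ?t" using s[of i "k - 1"] by simp
      then show ?thesis using True w(2)[of i] i by (simp add: mult_left_le)
    next
      case False
      then have "s i - ?t \<le> 0" using s[of "k - 1" i] by simp
      then show ?thesis using False w(1)[of i] i by (simp add: mult_nonpos_nonneg)
    qed
  qed
  also have "\<dots> = (\<Sum>i<k. s i - ?t)"
    using assms(2) by (intro sum.mono_neutral_cong_right) auto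
  finally show ?thesis
    using w(3) by (simp add: left_diff_distrib sum_subtractf flip: sum_distrib_left)
qed

section \<open>Leading left singular vectors and Ky Fan's principle\<close>

lemma orth_cols_norm_transpose_le:
  fixes V :: "real^'k::finite^'m::finite"
  assumes "V \<in> orth_cols"
  shows "norm (transpose V *v x) \<le> norm x"
  by (metis assms mult_left_le_one_le norm_ge_zero order_trans orth_cols_spec spec_norm_nonneg
      spec_norm_transpose spec_norm_vec)

lemma transpose_nth: "transpose V $ q = column q V"
  by (simp add: transpose_def column_def)

lemma transpose_vec_nth: "(transpose V *v x) $ q = column q V \<bullet> x"
  for V :: "real^'k::finite^'m::finite"
  by (simp add: matrix_vector_mul_component transpose_nth)

text \<open>A witness of \<open>lead_left\<close> unpacked, so that all facts below refer to the
  same decomposition. The bijection \<open>f\<close> leaves the order of the columns open. Because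
  \<open>u\<close> is a full basis of the left space, \<open>Q\<close> has orthonormal columns even
  if \<open>CARD('k)\<close> exceeds \<open>CARD('n)\<close>. Indices start at 0, so
  \<open>s (CARD('k) - 1)\<close> is the smallest singular value belonging to
  \<open>Q\<close>.\<close>

locale leading_vectors =
  fixes M :: "real^'n::finite^'m::finite" and s u v and f :: "'k::finite \<Rightarrow> nat" and Q :: "real^'k^'m"
  assumes svd: "is_svd M s u v" and f: "bij_betw f UNIV {..<CARD('k)}"
    and Q: "\<And>p q. Q $ p $ q = u (f q) $ p" and le: "CARD('k) \<le> CARD('m)"
begin

lemma column_Q: "column q Q = u (f q)"
  by (simp add: column_def Q vec_eq_iff)

lemma f_less: "f q < CARD('k)" using f by (auto simp: bij_betw_def)

lemma f_eq: "f p = f q \<longleftrightarrow> p = q" using f by (auto simp: bij_betw_def inj_on_def)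

lemma u: "orthonormal_upto CARD('m) u" using svd by (auto simp: is_svd_def)

lemma s_mono: "i \<le> j \<Longrightarrow> s j \<le> s i" and s_nonneg: "0 \<le> s i"
  using svd by (auto simp: is_svd_def)

lemma Q_orth: "Q \<in> orth_cols"
proof -
  have "f q < CARD('m)" for q using f_less[of q] le by simp
  then show ?thesis using u by (simp add: orth_cols_iff column_Q f_eq)
qed

lemma u_Q:
  assumes "CARD('k) \<le> i" "i < CARD('m)"
  shows "u i \<bullet> (Q *v y) = 0"
proof -
  have "f q < CARD('m)" "f q \<noteq> i" for q using f_less[of q] le assms by auto
  then have "transpose Q *v u i = 0"
    using u assms by (simp add: vec_eq_iff transpose_vec_nth column_Q)
  then show ?thesis by (simp add: inner_matrix_vec)
qed

lemma u_perp:
  assumes "transpose Q *v p = 0" "i < CARD('k)"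
  shows "u i \<bullet> p = 0"
proof -
  obtain q where "i = f q" using f assms(2) by (auto simp: bij_betw_def)
  then show ?thesis using assms(1) by (metis column_Q transpose_vec_nth zero_index)
qed

lemma norm_gram: "(norm (transpose M *v x))\<^sup>2 = (\<Sum>i<CARD('m). (s i)\<^sup>2 * (u i \<bullet> x)\<^sup>2)"
  unfolding power2_norm_eq_inner is_svd_gram[OF svd] by (simp add: power2_eq_square mult_ac)

lemma norm_u: "(norm x)\<^sup>2 = (\<Sum>i<CARD('m). (u i \<bullet> x)\<^sup>2)"
  unfolding power2_norm_eq_inner parseval[OF u, of x x, symmetric] by (simp add: power2_eq_square)

text \<open>Vectors in the range of \<open>Q\<close> have no component along later
  \<open>u i\<close>, so only singular values at or above the threshold contribute.
  \<open>norm_perp_le\<close> is the mirror image for the orthogonal complement, and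
  \<open>gram_perp\<close> says that the two parts do not interact.\<close>

lemma norm_ge: "s (CARD('k) - 1) * norm y \<le> norm (transpose M *v (Q *v y))"
proof (rule power2_le_imp_le)
  have "(s (CARD('k) - 1) * norm y)\<^sup>2 = (s (CARD('k) - 1))\<^sup>2 * (norm (Q *v y))\<^sup>2"
    by (simp add: power_mult_distrib orth_cols_norm[OF Q_orth])
  also have "\<dots> = (\<Sum>i<CARD('m). (s (CARD('k) - 1))\<^sup>2 * (u i \<bullet> (Q *v y))\<^sup>2)"
    by (simp add: norm_u sum_distrib_left)
  also have "\<dots> \<le> (\<Sum>i<CARD('m). (s i)\<^sup>2 * (u i \<bullet> (Q *v y))\<^sup>2)"
  proof (rule sum_mono)
    fix i assume "i \<in> {..<CARD('m)}"
    then show "(s (CARD('k) - 1))\<^sup>2 * (u i \<bullet> (Q *v y))\<^sup>2 \<le> (s i)\<^sup>2 * (u i \<bullet> (Q *v y))\<^sup>2"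
      using s_mono[of i "CARD('k) - 1"] u_Q[of i] s_nonneg
      by (cases "i < CARD('k)") (auto intro!: mult_right_mono power_mono)
  qed
  finally show "(s (CARD('k) - 1) * norm y)\<^sup>2 \<le> (norm (transpose M *v (Q *v y)))\<^sup>2"
    by (simp add: norm_gram)
qed simp

lemma norm_perp_le:
  assumes "transpose Q *v p = 0"
  shows "norm (transpose M *v p) \<le> s (CARD('k) - 1) * norm p"
proof (rule power2_le_imp_le)
  have "(norm (transpose M *v p))\<^sup>2 \<le> (\<Sum>i<CARD('m). (s (CARD('k) - 1))\<^sup>2 * (u i \<bullet> p)\<^sup>2)"
    unfolding norm_gram
  proof (rule sum_mono)
    fix i assume "i \<in> {..<CARD('m)}"
    then show "(s i)\<^sup>2 * (u i \<bullet> p)\<^sup>2 \<le> (s (CARD('k) - 1))\<^sup>2 * (u i \<bullet> p)\<^sup>2"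
      using s_mono[of "CARD('k) - 1" i] u_perp[OF assms, of i] s_nonneg
      by (cases "i < CARD('k)") (auto intro!: mult_right_mono power_mono)
  qed
  also have "\<dots> = (s (CARD('k) - 1) * norm p)\<^sup>2"
    by (simp add: power_mult_distrib norm_u[of p] sum_distrib_left)
  finally show "(norm (transpose M *v p))\<^sup>2 \<le> (s (CARD('k) - 1) * norm p)\<^sup>2" .
qed (simp add: s_nonneg)

lemma gram_perp:
  assumes "transpose Q *v p = 0"
  shows "(transpose M *v (Q *v y)) \<bullet> (transpose M *v p) = 0"
  unfolding is_svd_gram[OF svd]
proof (rule sum.neutral, rule ballI)
  fix i assume "i \<in> {..<CARD('m)}"
  then show "(s i)\<^sup>2 * (u i \<bullet> (Q *v y)) * (u i \<bullet> p) = 0"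
    using u_Q[of i y] u_perp[OF assms, of i] by (cases "i < CARD('k)") auto
qed

text \<open>In the basis \<open>u\<close> the left side is a weighted sum of squared singular
  values. Each weight is at most 1 because \<open>transpose V\<close> is a contraction, and the
  weights sum to \<open>CARD('k)\<close>; the columns of \<open>Q\<close> attain the resulting
  maximum.\<close>

lemma ky_fan:
  fixes V :: "real^'k^'m"
  assumes V: "V \<in> orth_cols"
  shows "norm (transpose V ** M) \<le> norm (transpose Q ** M)"
proof (rule power2_le_imp_le)
  define w where "w i = (\<Sum>q\<in>(UNIV::'k set). (u i \<bullet> column q V)\<^sup>2)" for i
  have "(norm (transpose V ** M))\<^sup>2 = (\<Sum>q\<in>UNIV. \<Sum>i<CARD('m). (s i)\<^sup>2 * (u i \<bullet> column q V)\<^sup>2)"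
    by (simp add: norm_matrix_mul_sq norm_gram transpose_nth)
  also have "\<dots> = (\<Sum>i<CARD('m). (s i)\<^sup>2 * w i)"
    by (subst sum.swap) (simp add: w_def sum_distrib_left)
  also have "\<dots> \<le> (\<Sum>i<CARD('k). (s i)\<^sup>2)"
  proof (rule sum_weights_le)
    fix i assume i: "i < CARD('m)"
    have "w i = (norm (transpose V *v u i))\<^sup>2"
      unfolding w_def power2_norm_eq_inner inner_vec_def[of "transpose V *v u i"]
      by (simp add: transpose_vec_nth inner_commute power2_eq_square)
    also have "\<dots> \<le> (norm (u i))\<^sup>2"
      by (intro power_mono orth_cols_norm_transpose_le V norm_ge_zero)
    also have "\<dots> = 1" using u i by (simp add: power2_norm_eq_inner)
    finally show "w i \<le> 1" .
  next
    have "(\<Sum>i<CARD('m). w i) = (\<Sum>q\<in>UNIV. (norm (column q V))\<^sup>2)"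
      unfolding w_def by (subst sum.swap) (simp add: norm_u)
    also have "\<dots> = real CARD('k)"
      using V by (simp add: orth_cols_iff power2_norm_eq_inner)
    finally show "(\<Sum>i<CARD('m). w i) = real CARD('k)" .
  qed (use le s_mono s_nonneg in \<open>auto simp: w_def intro!: sum_nonneg power_mono\<close>)
  also have "\<dots> = (\<Sum>q\<in>UNIV. (s (f q))\<^sup>2)"
    by (rule sum.reindex_bij_betw[OF f, symmetric])
  also have "\<dots> = (norm (transpose Q ** M))\<^sup>2"
  proof -
    have "(norm (transpose M *v u (f q)))\<^sup>2 = (s (f q))\<^sup>2" for q
    proof -
      have fq: "f q < CARD('m)" using f_less[of q] le by simp
      have "(norm (transpose M *v u (f q)))\<^sup>2 = (\<Sum>i<CARD('m). if i = f q then (s i)\<^sup>2 else 0)"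
        unfolding norm_gram using u fq by (intro sum.cong) auto
      then show ?thesis using fq by simp
    qed
    then show ?thesis by (simp add: norm_matrix_mul_sq transpose_nth column_Q)
  qed
  finally show "(norm (transpose V ** M))\<^sup>2 \<le> (norm (transpose Q ** M))\<^sup>2" .
qed simp

end

lemma lead_leftE:
  fixes M :: "real^'n::finite^'m::finite" and Q :: "real^'k::finite^'m"
  assumes "lead_left M Q" "CARD('k) \<le> CARD('m)"
  obtains s u v f where "leading_vectors M s u v f Q"
  using assms unfolding lead_left_def leading_vectors_def by blast

lemma lead_left_orth: "lead_left M Q \<Longrightarrow> CARD('k) \<le> CARD('m) \<Longrightarrow> Q \<in> orth_cols"
  for M :: "real^'n::finite^'m::finite" and Q :: "real^'k::finite^'m"
  by (metis lead_leftE leading_vectors.Q_orth)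

lemma svd_leading_vectors:
  fixes M :: "real^'n::finite^'m::finite"
  assumes "is_svd M s u v" "CARD('k) \<le> CARD('m)"
  shows "\<exists>f Q. leading_vectors M s u v f (Q :: real^'k::finite^'m)"
proof -
  obtain f where f: "bij_betw f (UNIV::'k set) {..<CARD('k)}"
    using ex_bij_betw_finite_nat[of "UNIV::'k set"] by (auto simp: atLeast0LessThan)
  have "leading_vectors M s u v f (\<chi> p q. u (f q) $ p)"
    using assms f by unfold_locales auto
  then show ?thesis by blast
qed

text \<open>The columns of \<open>W\<close> may be dependent, so they cannot simply be normalised.
  As \<open>W\<close> has only \<open>CARD('k)\<close> columns, its left singular vectors beyond
  that number carry singular value 0, and the leading ones span the range.\<close>

lemma orth_cols_cover:
  fixes W :: "real^'k::finite^'m::finite"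
  assumes "CARD('k) \<le> CARD('m)"
  shows "\<exists>V\<in>(orth_cols :: (real^'k^'m) set). V ** transpose V ** W = W"
proof -
  obtain s u v where svd: "is_svd W s u v" using is_svd_exists by blast
  obtain f and V :: "real^'k^'m" where lv: "leading_vectors W s u v f V"
    using svd_leading_vectors[OF svd assms] by blast
  interpret leading_vectors W s u v f V by (rule lv)
  have s0: "s i = 0" if "CARD('k) \<le> i" for i
    using svd that unfolding is_svd_def by (metis min.coboundedI2)
  have "transpose W *v (x - V *v (transpose V *v x)) = 0" for x
  proof -
    let ?p = "x - V *v (transpose V *v x)"
    have "transpose V *v ?p = 0"
      by (simp add: matrix_vector_mult_diff_distrib orth_cols_left[OF Q_orth])
    then have "(norm (transpose W *v ?p))\<^sup>2 = 0"
      unfolding norm_gram using u_perp s0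
      by (intro sum.neutral ballI) (metis linorder_not_le mult_zero_left mult_zero_right power_zero_numeral)
    then show ?thesis by simp
  qed
  then have "transpose W *v x = transpose (V ** transpose V ** W) *v x" for x
    by (simp add: matrix_vector_mult_diff_distrib matrix_transpose_mul transpose_transpose matrix_vector_mul_assoc matrix_mul_assoc)
  then have "transpose W = transpose (V ** transpose V ** W)" by (simp add: matrix_eq)
  then have "V ** transpose V ** W = W" by (metis transpose_transpose)
  then show ?thesis using Q_orth by blast
qed

section \<open>Perturbation of leading singular subspaces\<close>

text \<open>With \<open>N\<close> the left-hand side, Ky Fan's optimality of \<open>Q\<close>, compared with \<open>U\<close>, reads
  \<open>\<parallel>N\<parallel>\<^sup>2 \<le> - 2 (N \<bullet> Z) + \<parallel>Q\<^sup>T Z\<parallel>\<^sup>2\<close>. As \<open>N\<close> has at most the rank of \<open>U\<close>, only a compression of \<open>Z\<close>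
  enters \<open>N \<bullet> Z\<close>, whence \<open>\<parallel>N\<parallel> \<le> (1 + sqrt 2) B\<close>.\<close>
lemma frobenius_perturbation:
  fixes A Z :: "real^'n::finite^'m::finite" and U Q :: "real^'k::finite^'m"
  assumes le: "CARD('k) \<le> CARD('m)" and U: "U \<in> orth_cols" and A: "U ** transpose U ** A = A"
    and Q: "lead_left (A + Z) Q"
    and B: "\<And>V::real^'k^'m. V \<in> orth_cols \<Longrightarrow> norm (transpose V ** Z) \<le> B"
  shows "norm (A - Q ** transpose Q ** A) \<le> 5 / 2 * B"
proof -
  define N where "N = A - Q ** transpose Q ** A"
  have Qo: "Q \<in> orth_cols" by (rule lead_left_orth[OF Q le])
  have QQ: "transpose Q ** Q = mat 1" and UU: "transpose U ** U = mat 1"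
    using Qo U by (simp_all add: orth_cols_def)
  have pyth: "(norm (transpose Q ** A))\<^sup>2 = (norm A)\<^sup>2 - (norm N)\<^sup>2"
  proof -
    have "(transpose Q ** A) \<bullet> (transpose Q ** A) = A \<bullet> (Q ** transpose Q ** A)"
      by (simp add: inner_mul_left transpose_transpose matrix_mul_assoc)
    moreover have "(Q ** transpose Q ** A) \<bullet> (Q ** transpose Q ** A) = A \<bullet> (Q ** transpose Q ** A)"
      by (simp add: inner_mul_left[of "Q ** transpose Q"] matrix_transpose_mul transpose_transpose
          matrix_mul_assoc) (simp add: QQ flip: matrix_mul_assoc[of Q "transpose Q" Q])
    ultimately show ?thesis
      by (simp add: N_def power2_norm_eq_inner inner_diff_left inner_diff_right inner_commute)
  qed
  have normU: "norm (transpose U ** A) = norm A"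
  proof -
    have "(transpose U ** A) \<bullet> (transpose U ** A) = A \<bullet> A"
      by (simp add: inner_mul_left transpose_transpose matrix_mul_assoc A)
    then show ?thesis by (simp add: norm_eq_sqrt_inner)
  qed
  have crossU: "(transpose U ** A) \<bullet> (transpose U ** Z) = A \<bullet> Z"
    by (metis A inner_mul_left inner_commute matrix_mul_assoc transpose_transpose)
  have crossQ: "(transpose Q ** A) \<bullet> (transpose Q ** Z) = A \<bullet> Z - N \<bullet> Z"
  proof -
    have "(transpose Q ** A) \<bullet> (transpose Q ** Z) = (Q ** transpose Q ** A) \<bullet> Z"
      by (metis inner_mul_left inner_commute matrix_mul_assoc transpose_transpose)
    then show ?thesis by (simp add: N_def inner_diff_left)
  qed
  have sq: "(norm (X + Y))\<^sup>2 = (norm X)\<^sup>2 + 2 * (X \<bullet> Y) + (norm Y)\<^sup>2" for X Y :: "real^'n^'k"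
    by (simp add: power2_norm_eq_inner inner_add_left inner_add_right inner_commute)
  obtain s u v f where "leading_vectors (A + Z) s u v f Q" using lead_leftE[OF Q le] by blast
  then have "norm (transpose U ** (A + Z)) \<le> norm (transpose Q ** (A + Z))"
    using U by (rule leading_vectors.ky_fan)
  then have "(norm (transpose U ** A + transpose U ** Z))\<^sup>2 \<le> (norm (transpose Q ** A + transpose Q ** Z))\<^sup>2"
    by (simp add: matrix_add_ldistrib power_mono)
  \<comment> \<open>After expanding both squares the terms in the norm of \<open>A\<close> and in
    \<open>A \<bullet> Z\<close> cancel, and the square of \<open>transpose U ** Z\<close> is
    dropped.\<close>
  then have 1: "(norm N)\<^sup>2 \<le> - 2 * (N \<bullet> Z) + (norm (transpose Q ** Z))\<^sup>2"
    unfolding sq pyth normU crossU crossQ using zero_le_power2[of "norm (transpose U ** Z)"]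
    by argo
  obtain V :: "real^'k^'m" where V: "V \<in> orth_cols"
    and cover: "V ** transpose V ** (U - Q ** transpose Q ** U) = U - Q ** transpose Q ** U"
    using orth_cols_cover[OF le] by blast
  \<comment> \<open>The residual of \<open>U\<close> has \<open>CARD('k)\<close> columns and is a
    left factor of \<open>N\<close>, so the \<open>V\<close> covering it also covers
    \<open>N\<close>.\<close>
  have "N = (U - Q ** transpose Q ** U) ** (transpose U ** A)"
    unfolding N_def matrix_diff_rdistrib using A by (metis matrix_mul_assoc)
  then have VN: "V ** transpose V ** N = N" using cover by (metis matrix_mul_assoc)
  have B0: "0 \<le> B" using B[OF V] norm_ge_zero order_trans by blast
  have "\<bar>N \<bullet> Z\<bar> = \<bar>(transpose V ** N) \<bullet> (transpose V ** Z)\<bar>"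
    by (metis VN inner_mul_left inner_commute matrix_mul_assoc transpose_transpose)
  also have "\<dots> \<le> norm (transpose V ** N) * norm (transpose V ** Z)"
    by (rule Cauchy_Schwarz_ineq2)
  also have "\<dots> \<le> norm N * B"
  proof (intro mult_mono B V norm_ge_zero)
    have "norm (transpose V ** N) \<le> spec_norm (transpose V) * norm N" by (rule norm_matrix_mul_le)
    also have "\<dots> \<le> 1 * norm N"
      using orth_cols_spec[OF V] by (intro mult_right_mono) (simp_all add: spec_norm_transpose)
    finally show "norm (transpose V ** N) \<le> norm N" by simp
  qed
  finally have "\<bar>N \<bullet> Z\<bar> \<le> norm N * B" .
  moreover have "(norm (transpose Q ** Z))\<^sup>2 \<le> B\<^sup>2" using B[OF Qo] by (rule power_mono) simp
  ultimately have 2: "(norm N)\<^sup>2 \<le> 2 * (norm N * B) + B\<^sup>2" using 1 by linarith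
  \<comment> \<open>The exact root of the quadratic is (1 + sqrt 2) B; beyond 5/2 B the product N(N
    - 2B) is already at least 5/4 B^2.\<close>
  have "norm N \<le> 5 / 2 * B"
  proof (rule ccontr)
    assume "\<not> norm N \<le> 5 / 2 * B"
    then have n: "5 / 2 * B < norm N" by simp
    then have "5 / 2 * B * (B / 2) \<le> norm N * (norm N - 2 * B)" using B0 by (intro mult_mono) auto
    with 2 have "5 / 4 * B\<^sup>2 \<le> B\<^sup>2" by (simp add: power2_eq_square algebra_simps)
    then have "B = 0" by simp
    with 2 n show False by simp
  qed
  then show ?thesis by (simp add: N_def)
qed

text \<open>The span of \<open>p\<close> and the range of \<open>Q\<close> contains a nonzero vector orthogonal to the range of \<open>U\<close>,
  on which the transposes of \<open>M = A + Z\<close> and \<open>Z\<close> agree; on that span \<open>p\<close> minimises the Rayleigh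
  quotient of \<open>M M\<^sup>T\<close>.\<close>
lemma spectral_perturbation:
  fixes A Z :: "real^'n::finite^'m::finite" and U Q :: "real^'k::finite^'m"
  assumes le: "CARD('k) \<le> CARD('m)" and A: "U ** transpose U ** A = A"
    and Q: "lead_left (A + Z) Q" and p: "transpose Q *v p = 0"
  shows "norm (transpose A *v p) \<le> 2 * spec_norm Z * norm p"
proof -
  define M where "M = A + Z"
  define C where "C = transpose U ** Q"
  have Qo: "Q \<in> orth_cols" by (rule lead_left_orth[OF Q le])
  obtain s u v f where lv: "leading_vectors M s u v f Q" using lead_leftE[OF Q le] M_def by blast
  interpret leading_vectors M s u v f Q by (rule lv)
  define \<tau> where "\<tau> = s (CARD('k) - 1)"
  have tM: "transpose M *v x = transpose A *v x + transpose Z *v x" for x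
    by (simp add: M_def transpose_def matrix_vector_mult_def vec_eq_iff sum.distrib distrib_right)
  have Z: "norm (transpose Z *v x) \<le> spec_norm Z * norm x" for x
    by (metis spec_norm_transpose spec_norm_vec)
  have kill: "norm (transpose M *v w) \<le> spec_norm Z * norm w" if "transpose U *v w = 0" for w
  proof -
    have "transpose A *v w = transpose A *v (U *v (transpose U *v w))"
      by (subst A[symmetric]) (simp add: matrix_transpose_mul transpose_transpose matrix_vector_mul_assoc matrix_mul_assoc)
    then show ?thesis using that Z tM by simp
  qed
  have key: "norm (transpose M *v p) \<le> spec_norm Z * norm p"
  proof (cases "\<forall>y. C *v y = 0 \<longrightarrow> y = 0")
    case True
    then have "inj ((*v) C)"
      using linear_injective_0[of "(*v) C"] by simp
    then have "surj ((*v) C)"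
      by (metis linear_injective_imp_surjective matrix_vector_mul_linear)
    \<comment> \<open>\<open>C\<close> is square, so injectivity yields surjectivity, and a vector
      from the range of \<open>Q\<close> can cancel the component of \<open>p\<close> in the range
      of \<open>U\<close>.\<close>
    then obtain y where y: "C *v y = - (transpose U *v p)" by (metis surjD)
    define w where "w = Q *v y + p"
    have "transpose U *v w = 0"
      using y by (simp add: w_def C_def matrix_vector_right_distrib matrix_vector_mul_assoc)
    then have "(norm (transpose M *v w))\<^sup>2 \<le> (spec_norm Z * norm w)\<^sup>2"
      using kill by (intro power_mono) auto
    moreover have "(norm w)\<^sup>2 = (norm y)\<^sup>2 + (norm p)\<^sup>2"
    proof -
      have "p \<bullet> (Q *v y) = 0" using p by (simp add: inner_matrix_vec)
      then show ?thesis
        by (simp add: w_def power2_norm_eq_inner inner_add_left inner_add_right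
            orth_cols_inner[OF Qo] inner_commute)
    qed
    moreover have "(norm (transpose M *v w))\<^sup>2 = (norm (transpose M *v (Q *v y)))\<^sup>2 + (norm (transpose M *v p))\<^sup>2"
      using gram_perp[OF p, of y] by (simp add: w_def matrix_vector_right_distrib power2_norm_eq_inner
          inner_add_left inner_add_right inner_commute)
    moreover have "(\<tau> * norm y)\<^sup>2 \<le> (norm (transpose M *v (Q *v y)))\<^sup>2"
      unfolding \<tau>_def using norm_ge s_nonneg by (intro power_mono) auto
    ultimately have 1: "\<tau>\<^sup>2 * (norm y)\<^sup>2 + (norm (transpose M *v p))\<^sup>2
        \<le> (spec_norm Z)\<^sup>2 * ((norm y)\<^sup>2 + (norm p)\<^sup>2)"
      by (simp add: power_mult_distrib)
    \<comment> \<open>A violation would give \<open>spec_norm Z < \<tau>\<close> by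
      \<open>norm_perp_le\<close>. Then each summand on the left of \<open>1\<close> dominates its
      counterpart on the right, the second one strictly.\<close>
    show ?thesis
    proof (rule ccontr)
      assume "\<not> ?thesis"
      then have gt: "spec_norm Z * norm p < norm (transpose M *v p)" by simp
      also have "\<dots> \<le> \<tau> * norm p" unfolding \<tau>_def by (rule norm_perp_le[OF p])
      finally have "spec_norm Z < \<tau>" by (simp add: mult_less_cancel_right)
      then have "(spec_norm Z)\<^sup>2 * (norm y)\<^sup>2 \<le> \<tau>\<^sup>2 * (norm y)\<^sup>2"
        by (intro mult_right_mono power_mono) (auto simp: spec_norm_nonneg)
      moreover have "(spec_norm Z)\<^sup>2 * (norm p)\<^sup>2 < (norm (transpose M *v p))\<^sup>2"
        using gt by (metis norm_ge_zero mult_nonneg_nonneg power_mult_distrib power_strict_mono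
            spec_norm_nonneg zero_less_numeral)
      ultimately show False using 1 by (simp add: distrib_left)
    qed
  next
    case False
    \<comment> \<open>Here the range of \<open>Q\<close> itself contains a vector orthogonal to the
      range of \<open>U\<close>, which bounds the threshold \<tau> by the noise.\<close>
    then obtain y where y: "C *v y = 0" "y \<noteq> 0" by blast
    have "transpose U *v (Q *v y) = 0" using y by (simp add: C_def matrix_vector_mul_assoc)
    then have "norm (transpose M *v (Q *v y)) \<le> spec_norm Z * norm y"
      using kill by (metis orth_cols_norm Qo)
    then have "\<tau> * norm y \<le> spec_norm Z * norm y" using norm_ge[of y] unfolding \<tau>_def by linarith
    then have "\<tau> \<le> spec_norm Z" using y(2) by simp
    then have "\<tau> * norm p \<le> spec_norm Z * norm p" by (simp add: mult_right_mono)
    then show ?thesis using norm_perp_le[OF p] unfolding \<tau>_def by linarith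
  qed
  have "transpose A *v p = transpose M *v p - transpose Z *v p" by (simp add: tM)
  then have "norm (transpose A *v p) \<le> norm (transpose M *v p) + norm (transpose Z *v p)"
    by (simp add: norm_triangle_ineq4)
  then show ?thesis using key Z[of p] by simp
qed

text \<open>The range of \<open>A\<close> lies in that of \<open>U\<close>, so
  \<open>transpose A\<close> sees a leading singular vector only through its
  \<open>U\<close>-coordinates. If the singular value is positive, every \<open>y\<close> has the
  form \<open>transpose U *v (Q *v z)\<close> with \<open>z\<close> no shorter than
  \<open>y\<close>, and \<open>norm_ge\<close> applies to \<open>z\<close>.\<close>

lemma sing_val_le:
  fixes A :: "real^'n::finite^'m::finite" and U :: "real^'k::finite^'m"
  assumes le: "CARD('k) \<le> CARD('m)" and U: "U \<in> orth_cols" and A: "U ** transpose U ** A = A"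
  shows "sing_val A CARD('k) * norm y \<le> norm (transpose A *v (U *v y))"
proof -
  have "\<exists>x s u v. is_svd A s u v \<and> x = s (CARD('k) - 1)" using is_svd_exists by blast
  then have "\<exists>s u v. is_svd A s u v \<and> sing_val A CARD('k) = s (CARD('k) - 1)"
    unfolding sing_val_def by (rule someI_ex)
  then obtain s u v where svd: "is_svd A s u v" and sv: "sing_val A CARD('k) = s (CARD('k) - 1)"
    by blast
  obtain f and Q :: "real^'k^'m" where lv: "leading_vectors A s u v f Q"
    using svd_leading_vectors[OF svd le] by blast
  interpret leading_vectors A s u v f Q by (rule lv)
  show ?thesis
  proof (cases "s (CARD('k) - 1) = 0")
    case True
    then show ?thesis by (simp add: sv)
  next
    case False
    then have pos: "0 < s (CARD('k) - 1)" using s_nonneg[of "CARD('k) - 1"] by simp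
    have AQ: "transpose A *v (Q *v z) = transpose A *v (U *v ((transpose U ** Q) *v z))" for z
      by (subst A[symmetric]) (simp add: matrix_transpose_mul transpose_transpose matrix_vector_mul_assoc matrix_mul_assoc)
    \<comment> \<open>By \<open>AQ\<close>, a kernel vector of \<open>transpose U ** Q\<close> is
      sent to 0 by \<open>transpose A\<close> after \<open>Q\<close>, contradicting the positive
      lower bound unless it is 0.\<close>
    have "z = 0" if "(transpose U ** Q) *v z = 0" for z
      using norm_ge[of z] pos that by (simp add: AQ mult_le_0_iff)
    then have "inj ((*v) (transpose U ** Q))"
      using linear_injective_0[of "(*v) (transpose U ** Q)"] by simp
    then have "surj ((*v) (transpose U ** Q))"
      by (metis linear_injective_imp_surjective matrix_vector_mul_linear)
    then obtain z where z: "y = (transpose U ** Q) *v z" by (metis surjD)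
    have "norm y \<le> norm (Q *v z)"
      unfolding z matrix_vector_mul_assoc[symmetric] by (rule orth_cols_norm_transpose_le[OF U])
    also have "\<dots> = norm z" by (rule orth_cols_norm[OF Q_orth])
    finally have "s (CARD('k) - 1) * norm y \<le> s (CARD('k) - 1) * norm z"
      using pos by simp
    then show ?thesis using norm_ge[of z] AQ[of z] z sv by simp
  qed
qed

text \<open>For orthonormal columns this is the sine of the largest principal angle between the two
  ranges. The transposed form is the factor that remains when \<open>transpose U\<close> is split
  along the range of \<open>W\<close>.\<close>

definition sin_theta :: "real^'k::finite^'m::finite \<Rightarrow> real^'k^'m \<Rightarrow> real" where
  "sin_theta U W = spec_norm (transpose U ** (mat 1 - W ** transpose W))"

lemma sin_theta_nonneg: "0 \<le> sin_theta U W"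
  by (simp add: sin_theta_def spec_norm_nonneg)

lemma sin_theta_transpose: "sin_theta U W = spec_norm ((mat 1 - W ** transpose W) ** U)"
proof -
  have "transpose (mat 1 - W ** transpose W) = mat 1 - W ** transpose W"
    by (simp add: transpose_def mat_def matrix_matrix_mult_def vec_eq_iff mult.commute eq_commute)
  then have "transpose (transpose U ** (mat 1 - W ** transpose W)) = (mat 1 - W ** transpose W) ** U"
    by (simp add: matrix_transpose_mul)
  then show ?thesis unfolding sin_theta_def by (metis spec_norm_transpose)
qed

lemma complement_vec: "(mat 1 - W ** transpose W) *v x = x - W *v (transpose W *v x)"
  for W :: "real^'k::finite^'m::finite"
  by (simp add: matrix_vector_mult_diff_rdistrib matrix_vector_mul_assoc)

text \<open>A Davis-Kahan type bound. Removing the \<open>Q\<close>-part of \<open>x\<close> leaves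
  a vector \<open>p\<close> to which \<open>spectral_perturbation\<close> applies, and \<sigma>
  converts the bound on \<open>transpose A *v p\<close> into one on
  \<open>transpose U *v p\<close>.\<close>

lemma sin_theta_perturbation:
  fixes A Z :: "real^'n::finite^'m::finite" and U Q :: "real^'k::finite^'m"
  assumes le: "CARD('k) \<le> CARD('m)" and A: "U ** transpose U ** A = A"
    and Q: "lead_left (A + Z) Q" and \<sigma>: "0 < \<sigma>" "\<And>y. \<sigma> * norm y \<le> norm (transpose A *v (U *v y))"
  shows "\<sigma> * sin_theta U Q \<le> 2 * spec_norm Z"
proof -
  have Qo: "Q \<in> orth_cols" by (rule lead_left_orth[OF Q le])
  have "sin_theta U Q \<le> 2 * spec_norm Z / \<sigma>"
    unfolding sin_theta_def
  proof (rule spec_norm_le)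
    fix x
    define p where "p = x - Q *v (transpose Q *v x)"
    have p0: "transpose Q *v p = 0"
      by (simp add: p_def matrix_vector_mult_diff_distrib orth_cols_left[OF Qo])
    have "transpose A *v p = transpose A *v (U *v (transpose U *v p))"
      by (subst A[symmetric]) (simp add: matrix_transpose_mul matrix_vector_mul_assoc matrix_mul_assoc)
    then have "\<sigma> * norm (transpose U *v p) \<le> norm (transpose A *v p)" using \<sigma>(2) by metis
    also have "\<dots> \<le> 2 * spec_norm Z * norm p" by (rule spectral_perturbation[OF le A Q p0])
    also have "\<dots> \<le> 2 * spec_norm Z * norm x"
    proof -
      have "(norm p)\<^sup>2 \<le> (norm x)\<^sup>2" unfolding p_def orth_proj_pyth[OF Qo] by simp
      then have "norm p \<le> norm x" by (rule power2_le_imp_le) simp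
      then show ?thesis by (simp add: mult_left_mono spec_norm_nonneg)
    qed
    finally have "norm (transpose U *v p) \<le> 2 * spec_norm Z / \<sigma> * norm x"
      using \<sigma>(1) by (simp add: field_simps)
    then show "norm ((transpose U ** (mat 1 - Q ** transpose Q)) *v x) \<le> 2 * spec_norm Z / \<sigma> * norm x"
      by (simp add: p_def complement_vec flip: matrix_vector_mul_assoc)
  qed
  then show ?thesis using \<sigma>(1) by (simp add: field_simps)
qed

lemma sin_theta_cos:
  fixes U Q :: "real^'k::finite^'m::finite"
  assumes U: "U \<in> orth_cols" and Q: "Q \<in> orth_cols" and c: "c\<^sup>2 + (sin_theta U Q)\<^sup>2 \<le> 1"
  shows "c * norm y \<le> norm (transpose Q *v (U *v y))"
proof (rule power2_le_imp_le)
  let ?x = "U *v y"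
  have "norm (?x - Q *v (transpose Q *v ?x)) \<le> sin_theta U Q * norm y"
    using spec_norm_vec[of "(mat 1 - Q ** transpose Q) ** U" y]
    unfolding sin_theta_transpose matrix_vector_mul_assoc[symmetric] complement_vec .
  then have "(norm (?x - Q *v (transpose Q *v ?x)))\<^sup>2 \<le> (sin_theta U Q * norm y)\<^sup>2"
    by (rule power_mono) simp
  then have "(norm y)\<^sup>2 - (norm (transpose Q *v ?x))\<^sup>2 \<le> (sin_theta U Q)\<^sup>2 * (norm y)\<^sup>2"
    unfolding orth_proj_pyth[OF Q] orth_cols_norm[OF U] power_mult_distrib .
  moreover have "(c\<^sup>2 + (sin_theta U Q)\<^sup>2) * (norm y)\<^sup>2 \<le> 1 * (norm y)\<^sup>2"
    using c by (rule mult_right_mono) simp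
  ultimately show "(c * norm y)\<^sup>2 \<le> (norm (transpose Q *v ?x))\<^sup>2"
    by (simp add: power_mult_distrib distrib_right)
qed simp

text \<open>A square matrix and its transpose have the same smallest singular value. The proof
  writes \<open>z = C *v y\<close> and applies Cauchy-Schwarz to the inner product of
  \<open>transpose C *v z\<close> and \<open>y\<close>.\<close>

lemma transpose_lower_bound:
  fixes C :: "real^'k::finite^'k"
  assumes c: "0 < c" and low: "\<And>y. c * norm y \<le> norm (C *v y)"
  shows "c * norm z \<le> norm (transpose C *v z)"
proof (cases "z = 0")
  case False
  have "y = 0" if "C *v y = 0" for y
    using low[of y] that c by (simp add: mult_le_0_iff)
  then have "inj ((*v) C)" using linear_injective_0[of "(*v) C"] by simp
  then have "surj ((*v) C)" by (metis linear_injective_imp_surjective matrix_vector_mul_linear)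
  then obtain y where y: "z = C *v y" by (metis surjD)
  have "c * (norm z)\<^sup>2 = c * ((transpose C *v z) \<bullet> y)"
    by (simp add: power2_norm_eq_inner y inner_matrix_vec)
  also have "\<dots> \<le> c * (norm (transpose C *v z) * norm y)"
    using c norm_cauchy_schwarz by (intro mult_left_mono) auto
  also have "\<dots> = norm (transpose C *v z) * (c * norm y)" by simp
  also have "\<dots> \<le> norm (transpose C *v z) * norm z"
    using low[of y] y by (intro mult_left_mono) auto
  finally show ?thesis using False by (simp add: power2_eq_square)
qed simp

text \<open>Perturbation bounds the sine with the true factor first, while splitting the noise
  produces it with the iterate first. The cosine matrix is square, so its lower bound passes to the
  transpose; a sine below 1 makes that bound positive.\<close>

lemma sin_theta_commute_le:
  fixes U Q :: "real^'k::finite^'m::finite"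
  assumes U: "U \<in> orth_cols" and Q: "Q \<in> orth_cols" and s: "sin_theta U Q < 1"
  shows "sin_theta Q U \<le> sin_theta U Q"
proof -
  define c where "c = sqrt (1 - (sin_theta U Q)\<^sup>2)"
  have lt: "(sin_theta U Q)\<^sup>2 < 1"
    using s sin_theta_nonneg[of U Q] by (simp add: power_less_one_iff abs_square_less_1)
  have c: "0 < c" "c\<^sup>2 = 1 - (sin_theta U Q)\<^sup>2" using lt by (simp_all add: c_def)
  have "c * norm y \<le> norm ((transpose Q ** U) *v y)" for y
    using sin_theta_cos[OF U Q, of c y] c(2) by (simp add: matrix_vector_mul_assoc)
  then have low: "c * norm z \<le> norm (transpose U *v (Q *v z))" for z
    using transpose_lower_bound[OF c(1), of "transpose Q ** U" z]
    by (simp add: matrix_transpose_mul matrix_vector_mul_assoc)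
  show ?thesis
    unfolding sin_theta_transpose[of Q U]
  proof (rule spec_norm_le)
    fix z
    have "(c * norm z)\<^sup>2 \<le> (norm (transpose U *v (Q *v z)))\<^sup>2"
      using low c by (intro power_mono) auto
    then have "(norm (Q *v z - U *v (transpose U *v (Q *v z))))\<^sup>2 \<le> (sin_theta U Q * norm z)\<^sup>2"
      unfolding orth_proj_pyth[OF U] orth_cols_norm[OF Q] power_mult_distrib c(2)
      by (simp add: algebra_simps)
    then have "norm (Q *v z - U *v (transpose U *v (Q *v z))) \<le> sin_theta U Q * norm z"
      by (rule power2_le_imp_le) (simp add: sin_theta_nonneg)
    then show "norm (((mat 1 - U ** transpose U) ** Q) *v z) \<le> sin_theta U Q * norm z"
      by (simp add: complement_vec flip: matrix_vector_mul_assoc)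
  qed
qed

lemma orth_transpose_mul_spec:
  fixes U Q :: "real^'k::finite^'m::finite"
  assumes "U \<in> orth_cols" "Q \<in> orth_cols"
  shows "spec_norm (transpose U ** Q) \<le> 1"
proof -
  have "spec_norm (transpose U ** Q) \<le> spec_norm (transpose U) * spec_norm Q" by (rule spec_norm_mul)
  also have "\<dots> \<le> 1 * 1"
    using assms by (intro mult_mono) (simp_all add: orth_cols_spec spec_norm_transpose spec_norm_nonneg)
  finally show ?thesis by simp
qed

text \<open>Applied column by column: every column of \<open>X\<close> lies in the range of
  \<open>V\<close>, where \<open>transpose Q\<close> shrinks lengths at most by the factor
  \<open>c\<close>.\<close>

lemma norm_lower_bound:
  fixes X :: "real^'n::finite^'m::finite" and V Q :: "real^'k::finite^'m"
  assumes X: "V ** transpose V ** X = X" and V: "V \<in> orth_cols" and c0: "0 \<le> c"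
    and c: "\<And>y. c * norm y \<le> norm (transpose Q *v (V *v y))"
  shows "c * norm X \<le> norm (transpose Q ** X)"
proof (rule power2_le_imp_le)
  have *: "c * norm (transpose X $ i) \<le> norm (transpose Q *v (transpose X $ i))" for i
  proof -
    have "transpose X $ i = (V ** transpose V) *v (transpose X $ i)"
      using X by (metis matrix_mul_row matrix_transpose_mul transpose_transpose)
    then have eq: "transpose X $ i = V *v (transpose V *v (transpose X $ i))"
      by (simp add: matrix_vector_mul_assoc)
    show ?thesis
      using c[of "transpose V *v (transpose X $ i)"] eq orth_cols_norm[OF V] by metis
  qed
  have "(c * norm X)\<^sup>2 = (\<Sum>i\<in>UNIV. (c * norm (transpose X $ i))\<^sup>2)"
    by (simp add: power_mult_distrib norm_matrix_sq[of "transpose X"] sum_distrib_left flip: norm_transpose[of X])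
  also have "\<dots> \<le> (\<Sum>i\<in>UNIV. (norm (transpose Q *v (transpose X $ i)))\<^sup>2)"
    using * c0 by (intro sum_mono power_mono) auto
  also have "\<dots> = (norm (transpose X ** Q))\<^sup>2" by (simp add: norm_matrix_mul_sq)
  also have "\<dots> = (norm (transpose Q ** X))\<^sup>2"
    by (metis matrix_transpose_mul norm_transpose transpose_transpose)
  finally show "(c * norm X)\<^sup>2 \<le> (norm (transpose Q ** X))\<^sup>2" .
qed simp

section \<open>Mode products and unfoldings\<close>

lemma tfro_eq_norm: "tfro T = norm T"
  by (simp add: tfro_def norm_eq_sqrt_inner inner_vec_def power2_eq_square)

lemma unfold1_mode1: "unfold1 (mode1 M T) = M ** unfold1 T"
  by (simp add: unfold1_def mode1_def matrix_matrix_mult_def vec_eq_iff)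

lemma unfold3_mode3: "unfold3 (mode3 M T) = M ** unfold3 T"
  by (simp add: unfold3_def mode3_def matrix_matrix_mult_def vec_eq_iff)

lemma unfold1_add: "unfold1 (S + T) = unfold1 S + unfold1 T"
  by (simp add: unfold1_def vec_eq_iff)

lemma unfold3_add: "unfold3 (S + T) = unfold3 S + unfold3 T"
  by (simp add: unfold3_def vec_eq_iff)

lemma unfold1_diff: "unfold1 (S - T) = unfold1 S - unfold1 T"
  by (simp add: unfold1_def vec_eq_iff)

lemma unfold3_diff: "unfold3 (S - T) = unfold3 S - unfold3 T"
  by (simp add: unfold3_def vec_eq_iff)

lemma unfold1_eq_iff: "unfold1 S = unfold1 T \<longleftrightarrow> S = T"
  by (auto simp: unfold1_def vec_eq_iff)

lemma unfold3_eq_iff: "unfold3 S = unfold3 T \<longleftrightarrow> S = T"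
  by (auto simp: unfold3_def vec_eq_iff)

lemma norm_unfold1: "norm (unfold1 T) = norm T"
  by (simp add: norm_eq_sqrt_inner inner_vec_def unfold1_def sum.cartesian_product split_def flip: UNIV_Times_UNIV)

lemma norm_unfold3: "norm (unfold3 T) = norm T" for T :: "('a::finite,'b::finite,'c::finite) tensor"
proof -
  have "(\<Sum>c\<in>UNIV. \<Sum>a\<in>UNIV. \<Sum>b\<in>UNIV. T$a$b$c * T$a$b$c) = (\<Sum>a\<in>UNIV. \<Sum>c\<in>UNIV. \<Sum>b\<in>UNIV. T$a$b$c * T$a$b$c)"
    by (rule sum.swap)
  also have "\<dots> = (\<Sum>a\<in>UNIV. \<Sum>b\<in>UNIV. \<Sum>c\<in>UNIV. T$a$b$c * T$a$b$c)"
    by (intro sum.cong refl sum.swap)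
  finally show ?thesis
    by (simp add: norm_eq_sqrt_inner inner_vec_def unfold3_def sum.cartesian_product split_def flip: UNIV_Times_UNIV)
qed

lemma mode_commute: "mode3 B (mode1 A T) = mode1 A (mode3 B T)"
proof -
  have "(\<Sum>c\<in>UNIV. B$q$c * (\<Sum>a\<in>UNIV. A$p$a * T$a$b$c)) = (\<Sum>a\<in>UNIV. A$p$a * (\<Sum>c\<in>UNIV. B$q$c * T$a$b$c))" for p q b
    unfolding sum_distrib_left by (subst sum.swap) (simp add: mult_ac)
  then show ?thesis by (simp add: mode1_def mode3_def vec_eq_iff)
qed

lemma mode1_mode1: "mode1 A (mode1 B T) = mode1 (A ** B) T"
  by (simp add: unfold1_mode1 matrix_mul_assoc flip: unfold1_eq_iff)

lemma mode3_mode3: "mode3 A (mode3 B T) = mode3 (A ** B) T"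
  by (simp add: unfold3_mode3 matrix_mul_assoc flip: unfold3_eq_iff)

lemma mode1_add: "mode1 A (S + T) = mode1 A S + mode1 A T"
  by (simp add: unfold1_mode1 unfold1_add matrix_add_ldistrib flip: unfold1_eq_iff)

lemma mode3_add: "mode3 A (S + T) = mode3 A S + mode3 A T"
  by (simp add: unfold3_mode3 unfold3_add matrix_add_ldistrib flip: unfold3_eq_iff)

lemma mode1_diff: "mode1 A (S - T) = mode1 A S - mode1 A T"
  by (simp add: unfold1_mode1 unfold1_diff matrix_diff_ldistrib flip: unfold1_eq_iff)

lemma mode3_diff: "mode3 A (S - T) = mode3 A S - mode3 A T"
  by (simp add: unfold3_mode3 unfold3_diff matrix_diff_ldistrib flip: unfold3_eq_iff)

lemma mode1_add_matrix: "mode1 (A + B) T = mode1 A T + mode1 B T"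
  by (simp add: unfold1_mode1 unfold1_add matrix_add_rdistrib flip: unfold1_eq_iff)

lemma mode3_add_matrix: "mode3 (A + B) T = mode3 A T + mode3 B T"
  by (simp add: unfold3_mode3 unfold3_add matrix_add_rdistrib flip: unfold3_eq_iff)

lemma norm_mode1_le: "norm (mode1 A T) \<le> spec_norm A * norm T"
  unfolding norm_unfold1[symmetric] unfold1_mode1 by (rule norm_matrix_mul_le)

lemma norm_mode3_le: "norm (mode3 A T) \<le> spec_norm A * norm T"
  unfolding norm_unfold3[symmetric] unfold3_mode3 by (rule norm_matrix_mul_le)

text \<open>Turns contraction of a mode with a vector into a mode product. Transposed unfoldings
  applied to a vector then become norms of tensors, and the commutation of modes 1 and 3 replaces
  Kronecker algebra.\<close>

definition row_matrix :: "real^'n \<Rightarrow> real^'n^1" where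
  "row_matrix x = (\<chi> i. x)"

lemma norm_row_mul: "norm (row_matrix x ** X) = norm (transpose X *v x)"
  for X :: "real^'n::finite^'m::finite"
proof -
  have "(norm (row_matrix x ** X))\<^sup>2 = (norm (transpose X *v x))\<^sup>2"
    by (simp add: norm_matrix_mul_sq row_matrix_def)
  then show ?thesis by simp
qed

lemma norm_mode1_row: "norm (mode1 (row_matrix x) T) = norm (transpose (unfold1 T) *v x)"
  by (simp add: unfold1_mode1 norm_row_mul flip: norm_unfold1)

lemma norm_mode3_row: "norm (mode3 (row_matrix x) T) = norm (transpose (unfold3 T) *v x)"
  by (simp add: unfold3_mode3 norm_row_mul flip: norm_unfold3)

text \<open>Tested on the transpose: contracting mode 1 with \<open>x\<close> commutes with
  \<open>B\<close> in mode 3, and \<open>B\<close> enlarges the Frobenius norm of the contracted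
  tensor by at most its spectral norm.\<close>

lemma spec_unfold1_mode3: "spec_norm (unfold1 (mode3 B T)) \<le> spec_norm B * spec_norm (unfold1 T)"
proof -
  have "spec_norm (transpose (unfold1 (mode3 B T))) \<le> spec_norm B * spec_norm (unfold1 T)"
  proof (rule spec_norm_le)
    fix x
    have "norm (transpose (unfold1 (mode3 B T)) *v x) = norm (mode3 B (mode1 (row_matrix x) T))"
      by (simp add: mode_commute flip: norm_mode1_row)
    also have "\<dots> \<le> spec_norm B * norm (transpose (unfold1 T) *v x)"
      using norm_mode3_le norm_mode1_row by metis
    also have "\<dots> \<le> spec_norm B * (spec_norm (unfold1 T) * norm x)"
      by (intro mult_left_mono spec_norm_nonneg) (metis spec_norm_transpose spec_norm_vec)
    finally show "norm (transpose (unfold1 (mode3 B T)) *v x) \<le> spec_norm B * spec_norm (unfold1 T) * norm x"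
      by simp
  qed
  then show ?thesis by (simp add: spec_norm_transpose)
qed

lemma spec_unfold3_mode1: "spec_norm (unfold3 (mode1 B T)) \<le> spec_norm B * spec_norm (unfold3 T)"
proof -
  have "spec_norm (transpose (unfold3 (mode1 B T))) \<le> spec_norm B * spec_norm (unfold3 T)"
  proof (rule spec_norm_le)
    fix x
    have "norm (transpose (unfold3 (mode1 B T)) *v x) = norm (mode1 B (mode3 (row_matrix x) T))"
      by (simp flip: norm_mode3_row mode_commute)
    also have "\<dots> \<le> spec_norm B * norm (transpose (unfold3 T) *v x)"
      using norm_mode1_le norm_mode3_row by metis
    also have "\<dots> \<le> spec_norm B * (spec_norm (unfold3 T) * norm x)"
      by (intro mult_left_mono spec_norm_nonneg) (metis spec_norm_transpose spec_norm_vec)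
    finally show "norm (transpose (unfold3 (mode1 B T)) *v x) \<le> spec_norm B * spec_norm (unfold3 T) * norm x"
      by simp
  qed
  then show ?thesis by (simp add: spec_norm_transpose)
qed

lemma mode3_lower_bound:
  fixes V Q :: "real^'k::finite^'c::finite"
  assumes "mode3 (V ** transpose V) S = S" "V \<in> orth_cols" "0 \<le> c"
    "\<And>y. c * norm y \<le> norm (transpose Q *v (V *v y))"
  shows "c * norm S \<le> norm (mode3 (transpose Q) S)"
  using norm_lower_bound[of V "unfold3 S" c Q] assms
  by (simp add: unfold3_mode3 norm_unfold3 flip: unfold3_eq_iff) (metis norm_unfold3 unfold3_mode3)

lemma mode1_lower_bound:
  fixes V Q :: "real^'k::finite^'c::finite"
  assumes "mode1 (V ** transpose V) S = S" "V \<in> orth_cols" "0 \<le> c"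
    "\<And>y. c * norm y \<le> norm (transpose Q *v (V *v y))"
  shows "c * norm S \<le> norm (mode1 (transpose Q) S)"
  using norm_lower_bound[of V "unfold1 S" c Q] assms
  by (simp add: unfold1_mode1 norm_unfold1 flip: unfold1_eq_iff) (metis norm_unfold1 unfold1_mode1)

lemma norm_mode1_orth: "U \<in> orth_cols \<Longrightarrow> norm (mode1 U T) = norm T"
  for U :: "real^'k::finite^'m::finite"
  by (metis norm_unfold1 unfold1_mode1 orth_cols_norm_mul)

lemma norm_mode3_orth: "U \<in> orth_cols \<Longrightarrow> norm (mode3 U T) = norm T"
  for U :: "real^'k::finite^'m::finite"
  by (metis norm_unfold3 unfold3_mode3 orth_cols_norm_mul)

text \<open>Identifies the Kronecker form in the hypothesis on the K-th singular value with the
  compressed noise whose supremum is \<open>bV\<close>.\<close>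

lemma unfold3_kron: "unfold3 E ** kron U (mat 1 :: real^'b^'b) = unfold3 (mode1 (transpose U) E)"
  for E :: "('a::finite,'b::finite,'c::finite) tensor"
proof -
  have "(\<Sum>p\<in>UNIV. E $ fst p $ snd p $ c * (U $ fst p $ j * (if snd p = b then 1 else 0)))
      = (\<Sum>a\<in>UNIV. U $ a $ j * E $ a $ b $ c)" for b c j
  proof -
    have "(\<Sum>p\<in>UNIV. E $ fst p $ snd p $ c * (U $ fst p $ j * (if snd p = b then 1 else 0)))
      = (\<Sum>a\<in>UNIV. \<Sum>b'\<in>UNIV. E $ a $ b' $ c * (U $ a $ j * (if b' = b then 1 else 0)))"
      by (simp add: sum.cartesian_product split_def flip: UNIV_Times_UNIV)
    then show ?thesis by (simp add: mult_delta_right mult.commute)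
  qed
  then show ?thesis
    by (simp add: matrix_matrix_mult_def kron_def mat_def unfold3_def mode1_def transpose_def vec_eq_iff)
qed

section \<open>Noise compressed by nearby subspaces\<close>

lemma spec_norm_add: "spec_norm (A + B) \<le> spec_norm A + spec_norm B"
  unfolding spec_norm_def matrix_vector_mult_add_rdistrib
  by (intro onorm_triangle matrix_vector_mul_bounded_linear)

lemma spec_norm_scaleR: "spec_norm (c *\<^sub>R A) = \<bar>c\<bar> * spec_norm A"
  unfolding spec_norm_def
  using onorm_scaleR[OF matrix_vector_mul_bounded_linear[of A], of c]
  by (simp add: scaleR_matrix_vector_assoc)

lemma unfold1_mode3_scaleR: "unfold1 (mode3 (c *\<^sub>R M) T) = c *\<^sub>R unfold1 (mode3 M T)"
  by (simp add: unfold1_def mode3_def vec_eq_iff sum_distrib_left mult_ac)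

lemma unfold3_mode1_scaleR: "unfold3 (mode1 (c *\<^sub>R M) T) = c *\<^sub>R unfold3 (mode1 M T)"
  by (simp add: unfold3_def mode1_def vec_eq_iff sum_distrib_left mult_ac)

text \<open>Scaling \<open>W\<close> to spectral norm 1 makes it admissible for \<open>b\<close>.
  Norm 0 cannot be rescaled and is settled by submultiplicativity.\<close>

lemma unfold1_mode3_homogeneous:
  fixes W :: "real^'c::finite^'k::finite"
  assumes b: "\<And>V::real^'k^'c. spec_norm V \<le> 1 \<Longrightarrow> spec_norm (unfold1 (mode3 (transpose V) E)) \<le> b"
  shows "spec_norm (unfold1 (mode3 W E)) \<le> b * spec_norm W"
proof (cases "spec_norm W = 0")
  case True
  then show ?thesis using spec_unfold1_mode3[of W E] by simp
next
  case False
  then have pos: "0 < spec_norm W" using spec_norm_nonneg[of W] by simp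
  define V where "V = transpose ((1 / spec_norm W) *\<^sub>R W)"
  have "spec_norm V = 1" using pos by (simp add: V_def spec_norm_transpose spec_norm_scaleR)
  then have "spec_norm (unfold1 (mode3 (transpose V) E)) \<le> b" using b by simp
  then show ?thesis using pos
    by (simp add: V_def unfold1_mode3_scaleR spec_norm_scaleR field_simps)
qed

lemma unfold3_mode1_homogeneous:
  fixes W :: "real^'a::finite^'j::finite"
  assumes b: "\<And>U::real^'j^'a. spec_norm U \<le> 1 \<Longrightarrow> spec_norm (unfold3 (mode1 (transpose U) E)) \<le> b"
  shows "spec_norm (unfold3 (mode1 W E)) \<le> b * spec_norm W"
proof (cases "spec_norm W = 0")
  case True
  then show ?thesis using spec_unfold3_mode1[of W E] by simp
next
  case False
  then have pos: "0 < spec_norm W" using spec_norm_nonneg[of W] by simp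
  define U where "U = transpose ((1 / spec_norm W) *\<^sub>R W)"
  have "spec_norm U = 1" using pos by (simp add: U_def spec_norm_transpose spec_norm_scaleR)
  then have "spec_norm (unfold3 (mode1 (transpose U) E)) \<le> b" using b by simp
  then show ?thesis using pos
    by (simp add: U_def unfold3_mode1_scaleR spec_norm_scaleR field_simps)
qed

lemma transpose_split:
  "transpose V = (transpose V ** W) ** transpose W + transpose V ** (mat 1 - W ** transpose W)"
  for V W :: "real^'k::finite^'c::finite"
  by (simp add: matrix_diff_ldistrib matrix_mul_assoc)

lemma mode3_transpose_split:
  "mode3 (transpose V) E = mode3 (transpose V ** W) (mode3 (transpose W) E)
     + mode3 (transpose V ** (mat 1 - W ** transpose W)) E"
  for V W :: "real^'k::finite^'c::finite"
  unfolding mode3_mode3 mode3_add_matrix[symmetric] by (rule arg_cong[OF transpose_split])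

lemma mode1_transpose_split:
  "mode1 (transpose V) E = mode1 (transpose V ** W) (mode1 (transpose W) E)
     + mode1 (transpose V ** (mat 1 - W ** transpose W)) E"
  for V W :: "real^'k::finite^'a::finite"
  unfolding mode1_mode1 mode1_add_matrix[symmetric] by (rule arg_cong[OF transpose_split])

text \<open>Inside the range of \<open>W\<close> the compression by \<open>V\<close> is a
  contraction of the compression by \<open>W\<close>; outside it, homogeneity charges
  \<open>b\<close> times the sine.\<close>

lemma noise_unfold1:
  fixes V W :: "real^'k::finite^'c::finite"
  assumes V: "V \<in> orth_cols" and W: "W \<in> orth_cols"
    and b: "\<And>V::real^'k^'c. spec_norm V \<le> 1 \<Longrightarrow> spec_norm (unfold1 (mode3 (transpose V) E)) \<le> b"
  shows "spec_norm (unfold1 (mode3 (transpose V) E))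
     \<le> spec_norm (unfold1 (mode3 (transpose W) E)) + b * sin_theta V W"
proof -
  have "spec_norm (unfold1 (mode3 (transpose V ** W) (mode3 (transpose W) E)))
      \<le> 1 * spec_norm (unfold1 (mode3 (transpose W) E))"
    by (rule order_trans[OF spec_unfold1_mode3])
       (intro mult_right_mono orth_transpose_mul_spec V W spec_norm_nonneg)
  moreover have "spec_norm (unfold1 (mode3 (transpose V ** (mat 1 - W ** transpose W)) E)) \<le> b * sin_theta V W"
    unfolding sin_theta_def by (rule unfold1_mode3_homogeneous[OF b])
  ultimately show ?thesis
    unfolding mode3_transpose_split[of V E W] unfold1_add
    by (intro order_trans[OF spec_norm_add]) simp
qed

lemma noise_unfold3:
  fixes U W :: "real^'j::finite^'a::finite"
  assumes U: "U \<in> orth_cols" and W: "W \<in> orth_cols"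
    and b: "\<And>U::real^'j^'a. spec_norm U \<le> 1 \<Longrightarrow> spec_norm (unfold3 (mode1 (transpose U) E)) \<le> b"
  shows "spec_norm (unfold3 (mode1 (transpose U) E))
     \<le> spec_norm (unfold3 (mode1 (transpose W) E)) + b * sin_theta U W"
proof -
  have "spec_norm (unfold3 (mode1 (transpose U ** W) (mode1 (transpose W) E)))
      \<le> 1 * spec_norm (unfold3 (mode1 (transpose W) E))"
    by (rule order_trans[OF spec_unfold3_mode1])
       (intro mult_right_mono orth_transpose_mul_spec U W spec_norm_nonneg)
  moreover have "spec_norm (unfold3 (mode1 (transpose U ** (mat 1 - W ** transpose W)) E)) \<le> b * sin_theta U W"
    unfolding sin_theta_def by (rule unfold3_mode1_homogeneous[OF b])
  ultimately show ?thesis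
    unfolding mode1_transpose_split[of U E W] unfold3_add
    by (intro order_trans[OF spec_norm_add]) simp
qed

lemma norm_mode1_orth_transpose_le:
  fixes U :: "real^'j::finite^'a::finite"
  assumes "U \<in> orth_cols"
  shows "norm (mode1 (transpose U) X) \<le> sqrt (real CARD('j)) * spec_norm (unfold1 X)"
proof -
  have "norm (mode1 (transpose U) X) \<le> sqrt (real CARD('j)) * (spec_norm (transpose U) * spec_norm (unfold1 X))"
    unfolding norm_unfold1[symmetric, of "mode1 (transpose U) X"] unfold1_mode1 by (rule norm_mul_le_sqrt_card)
  also have "\<dots> \<le> sqrt (real CARD('j)) * (1 * spec_norm (unfold1 X))"
    using orth_cols_spec[OF assms]
    by (intro mult_left_mono mult_right_mono) (simp_all add: spec_norm_nonneg spec_norm_transpose)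
  finally show ?thesis by simp
qed

lemma norm_mode3_orth_transpose_le:
  fixes V :: "real^'k::finite^'c::finite"
  assumes "V \<in> orth_cols"
  shows "norm (mode3 (transpose V) X) \<le> sqrt (real CARD('k)) * spec_norm (unfold3 X)"
proof -
  have "norm (mode3 (transpose V) X) \<le> sqrt (real CARD('k)) * (spec_norm (transpose V) * spec_norm (unfold3 X))"
    unfolding norm_unfold3[symmetric, of "mode3 (transpose V) X"] unfold3_mode3 by (rule norm_mul_le_sqrt_card)
  also have "\<dots> \<le> sqrt (real CARD('k)) * (1 * spec_norm (unfold3 X))"
    using orth_cols_spec[OF assms]
    by (intro mult_left_mono mult_right_mono) (simp_all add: spec_norm_nonneg spec_norm_transpose)
  finally show ?thesis by simp
qed

text \<open>The part of \<open>U\<close> outside the range of \<open>W\<close> is bounded in two ways. The second one matters: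
  \<open>bV\<close> is not controlled by \<open>\<sigma>\<^sub>J\<close>, so the initialisation error must be paired with \<open>bU\<close>.\<close>
lemma noise_frobenius:
  fixes U W :: "real^'j::finite^'a::finite" and V :: "real^'k::finite^'c::finite"
  assumes U: "U \<in> orth_cols" and W: "W \<in> orth_cols" and V: "V \<in> orth_cols"
    and bU: "\<And>V::real^'k^'c. spec_norm V \<le> 1 \<Longrightarrow> spec_norm (unfold1 (mode3 (transpose V) E)) \<le> bU"
    and bV: "\<And>U::real^'j^'a. spec_norm U \<le> 1 \<Longrightarrow> spec_norm (unfold3 (mode1 (transpose U) E)) \<le> bV"
    and \<theta>: "sin_theta U W \<le> g + h" "0 \<le> g" "0 \<le> h"
  shows "norm (mode3 (transpose V) (mode1 (transpose U) E))
    \<le> sqrt (real CARD('k)) * spec_norm (unfold3 (mode1 (transpose W) E))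
      + sqrt (real CARD('k)) * bV * g + sqrt (real CARD('j)) * bU * h"
proof -
  define D where "D = transpose U ** (mat 1 - W ** transpose W)"
  define n where "n = norm (mode3 (transpose V) (mode1 D E))"
  let ?p = "sqrt (real CARD('j))" and ?q = "sqrt (real CARD('k))"
  have D: "spec_norm D \<le> g + h" using \<theta>(1) by (simp add: D_def sin_theta_def)
  have bU': "spec_norm (unfold1 (mode3 (transpose V) E)) \<le> bU" by (rule bU[OF orth_cols_spec[OF V]])
  have bV': "spec_norm (unfold3 (mode1 (transpose U) E)) \<le> bV" by (rule bV[OF orth_cols_spec[OF U]])
  have nn: "0 \<le> bU" "0 \<le> bV" using bU' bV' spec_norm_nonneg order_trans by blast+
  have "n \<le> ?q * spec_norm (unfold3 (mode1 D E))"
    unfolding n_def by (rule norm_mode3_orth_transpose_le[OF V])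
  also have "\<dots> \<le> ?q * (bV * spec_norm D)"
    by (intro mult_left_mono unfold3_mode1_homogeneous bV) auto
  also have "\<dots> \<le> ?q * (bV * (g + h))" using D nn by (intro mult_left_mono) auto
  finally have n1: "n \<le> (?q * bV) * (g + h)" by simp
  \<comment> \<open>Second bound for the same quantity: \<open>D\<close> is now the matrix with
    \<open>CARD('j)\<close> rows acting on noise already compressed by \<open>V\<close>, so sqrt J
    and \<open>bU\<close> appear.\<close>
  have "n = norm (D ** unfold1 (mode3 (transpose V) E))"
    by (simp add: n_def mode_commute unfold1_mode1 flip: norm_unfold1)
  also have "\<dots> \<le> ?p * (spec_norm D * spec_norm (unfold1 (mode3 (transpose V) E)))"
    by (rule norm_mul_le_sqrt_card)
  also have "\<dots> \<le> ?p * ((g + h) * bU)"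
    using D bU' \<theta> by (intro mult_left_mono mult_mono) (auto simp: spec_norm_nonneg)
  finally have n2: "n \<le> (?p * bU) * (g + h)" by (simp add: mult_ac)
  \<comment> \<open>The smaller of the two slopes, multiplied by g + h, is at most the first slope
    times g plus the second times h.\<close>
  have n: "n \<le> ?q * bV * g + ?p * bU * h"
  proof (cases "?q * bV \<le> ?p * bU")
    case True
    then have "?q * bV * h \<le> ?p * bU * h" using \<theta> by (intro mult_right_mono)
    then show ?thesis using n1 by (simp add: distrib_left)
  next
    case False
    then have "?p * bU * g \<le> ?q * bV * g" using \<theta> by (intro mult_right_mono) auto
    then show ?thesis using n2 by (simp add: distrib_left)
  qed
  have "norm (mode3 (transpose V) (mode1 (transpose U ** W) (mode1 (transpose W) E)))
      \<le> ?q * spec_norm (unfold3 (mode1 (transpose U ** W) (mode1 (transpose W) E)))"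
    by (rule norm_mode3_orth_transpose_le[OF V])
  also have "\<dots> \<le> ?q * (1 * spec_norm (unfold3 (mode1 (transpose W) E)))"
    by (intro mult_left_mono order_trans[OF spec_unfold3_mode1] mult_right_mono
        orth_transpose_mul_spec U W spec_norm_nonneg) auto
  finally show ?thesis
    unfolding mode1_transpose_split[of U E W] mode3_add
    using n by (intro order_trans[OF norm_triangle_ineq]) (simp add: n_def D_def)
qed

section \<open>One half step of the iteration\<close>

lemma mode1_update_sin_theta:
  fixes Us U :: "real^'j::finite^'a::finite" and Vs V :: "real^'k::finite^'c::finite"
  assumes le: "CARD('j) \<le> CARD('a)" and Us: "Us \<in> orth_cols" and Vs: "Vs \<in> orth_cols" and V: "V \<in> orth_cols"
    and T1: "mode1 (Us ** transpose Us) Ts = Ts" and T3: "mode3 (Vs ** transpose Vs) Ts = Ts"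
    and c: "0 < c" "c\<^sup>2 + (sin_theta Vs V)\<^sup>2 \<le> 1" and S: "0 < sing_val (unfold1 Ts) CARD('j)"
    and U: "lead_left (unfold1 (mode3 (transpose V) (Ts + E))) U"
  shows "c * sing_val (unfold1 Ts) CARD('j) * sin_theta Us U \<le> 2 * spec_norm (unfold1 (mode3 (transpose V) E))"
proof (rule sin_theta_perturbation[OF le])
  show "Us ** transpose Us ** unfold1 (mode3 (transpose V) Ts) = unfold1 (mode3 (transpose V) Ts)"
    by (simp add: T1 flip: unfold1_mode1 mode_commute)
  show "lead_left (unfold1 (mode3 (transpose V) Ts) + unfold1 (mode3 (transpose V) E)) U"
    using U by (simp add: mode3_add unfold1_add)
  show "0 < c * sing_val (unfold1 Ts) CARD('j)" using c S by simp
  fix y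
  let ?X = "mode1 (row_matrix (Us *v y)) Ts"
  have T1': "Us ** transpose Us ** unfold1 Ts = unfold1 Ts" by (simp add: T1 flip: unfold1_mode1)
  have "sing_val (unfold1 Ts) CARD('j) * norm y \<le> norm ?X"
    unfolding norm_mode1_row by (rule sing_val_le[OF le Us T1'])
  \<comment> \<open>The true tensor lies in the range of \<open>Vs\<close> along mode 3, so
    compressing it by \<open>V\<close> keeps at least the fraction \<open>c\<close>, a lower bound
    for the cosine, of the signal.\<close>
  then have "c * (sing_val (unfold1 Ts) CARD('j) * norm y) \<le> c * norm ?X"
    using c(1) by simp
  also have "\<dots> \<le> norm (mode3 (transpose V) ?X)"
  proof (rule mode3_lower_bound[OF _ Vs])
    show "mode3 (Vs ** transpose Vs) ?X = ?X" by (simp add: mode_commute T3)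
  qed (use c sin_theta_cos[OF Vs V] in auto)
  finally show "c * sing_val (unfold1 Ts) CARD('j) * norm y
      \<le> norm (transpose (unfold1 (mode3 (transpose V) Ts)) *v (Us *v y))"
    by (simp add: mode_commute flip: norm_mode1_row)
qed

lemma mode3_update_sin_theta:
  fixes Us U :: "real^'j::finite^'a::finite" and Vs V :: "real^'k::finite^'c::finite"
  assumes le: "CARD('k) \<le> CARD('c)" and Us: "Us \<in> orth_cols" and Vs: "Vs \<in> orth_cols" and U: "U \<in> orth_cols"
    and T1: "mode1 (Us ** transpose Us) Ts = Ts" and T3: "mode3 (Vs ** transpose Vs) Ts = Ts"
    and c: "0 < c" "c\<^sup>2 + (sin_theta Us U)\<^sup>2 \<le> 1" and R: "0 < sing_val (unfold3 Ts) CARD('k)"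
    and V: "lead_left (unfold3 (mode1 (transpose U) (Ts + E))) V"
  shows "c * sing_val (unfold3 Ts) CARD('k) * sin_theta Vs V \<le> 2 * spec_norm (unfold3 (mode1 (transpose U) E))"
proof (rule sin_theta_perturbation[OF le])
  show "Vs ** transpose Vs ** unfold3 (mode1 (transpose U) Ts) = unfold3 (mode1 (transpose U) Ts)"
    by (simp add: T3 mode_commute flip: unfold3_mode3)
  show "lead_left (unfold3 (mode1 (transpose U) Ts) + unfold3 (mode1 (transpose U) E)) V"
    using V by (simp add: mode1_add unfold3_add)
  show "0 < c * sing_val (unfold3 Ts) CARD('k)" using c R by simp
  fix y
  let ?X = "mode3 (row_matrix (Vs *v y)) Ts"
  have T3': "Vs ** transpose Vs ** unfold3 Ts = unfold3 Ts" by (simp add: T3 flip: unfold3_mode3)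
  have "sing_val (unfold3 Ts) CARD('k) * norm y \<le> norm ?X"
    unfolding norm_mode3_row by (rule sing_val_le[OF le Vs T3'])
  then have "c * (sing_val (unfold3 Ts) CARD('k) * norm y) \<le> c * norm ?X"
    using c(1) by simp
  also have "\<dots> \<le> norm (mode1 (transpose U) ?X)"
  proof (rule mode1_lower_bound[OF _ Us])
    show "mode1 (Us ** transpose Us) ?X = ?X" by (simp add: T1 flip: mode_commute)
  qed (use c sin_theta_cos[OF Us U] in auto)
  finally show "c * sing_val (unfold3 Ts) CARD('k) * norm y
      \<le> norm (transpose (unfold3 (mode1 (transpose U) Ts)) *v (Vs *v y))"
    by (simp flip: norm_mode3_row mode_commute)
qed

text \<open>The lost part is measured after compression by \<open>V\<close>, the form in which the
  update sees the tensor. This makes the bound independent of how close \<open>V\<close> is to the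
  true factor.\<close>

lemma mode1_update_frobenius:
  fixes Us U :: "real^'j::finite^'a::finite" and V :: "real^'k::finite^'c::finite"
  assumes le: "CARD('j) \<le> CARD('a)" and Us: "Us \<in> orth_cols"
    and T1: "mode1 (Us ** transpose Us) Ts = Ts"
    and U: "lead_left (unfold1 (mode3 (transpose V) (Ts + E))) U"
    and B: "\<And>U::real^'j^'a. U \<in> orth_cols \<Longrightarrow> norm (mode1 (transpose U) (mode3 (transpose V) E)) \<le> B"
  shows "norm (mode3 (transpose V) (Ts - mode1 (U ** transpose U) Ts)) \<le> 5 / 2 * B"
proof -
  let ?A = "unfold1 (mode3 (transpose V) Ts)"
  have "norm (?A - U ** transpose U ** ?A) \<le> 5 / 2 * B"
  proof (rule frobenius_perturbation[OF le Us])
    show "Us ** transpose Us ** ?A = ?A" by (simp add: T1 flip: unfold1_mode1 mode_commute)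
    show "lead_left (?A + unfold1 (mode3 (transpose V) E)) U"
      using U by (simp add: mode3_add unfold1_add)
  qed (use B in \<open>simp add: norm_unfold1 flip: unfold1_mode1\<close>)
  then show ?thesis
    by (simp add: mode3_diff mode_commute norm_unfold1 flip: unfold1_mode1 unfold1_diff)
qed

lemma mode3_update_frobenius:
  fixes U :: "real^'j::finite^'a::finite" and Vs V :: "real^'k::finite^'c::finite"
  assumes le: "CARD('k) \<le> CARD('c)" and Vs: "Vs \<in> orth_cols"
    and T3: "mode3 (Vs ** transpose Vs) Ts = Ts"
    and V: "lead_left (unfold3 (mode1 (transpose U) (Ts + E))) V"
    and B: "\<And>V::real^'k^'c. V \<in> orth_cols \<Longrightarrow> norm (mode3 (transpose V) (mode1 (transpose U) E)) \<le> B"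
  shows "norm (mode1 (transpose U) (Ts - mode3 (V ** transpose V) Ts)) \<le> 5 / 2 * B"
proof -
  let ?A = "unfold3 (mode1 (transpose U) Ts)"
  have "norm (?A - V ** transpose V ** ?A) \<le> 5 / 2 * B"
  proof (rule frobenius_perturbation[OF le Vs])
    show "Vs ** transpose Vs ** ?A = ?A" by (simp add: T3 mode_commute flip: unfold3_mode3)
    show "lead_left (?A + unfold3 (mode1 (transpose U) E)) V"
      using V by (simp add: mode1_add unfold3_add)
  qed (use B in \<open>simp add: norm_unfold3 flip: unfold3_mode3\<close>)
  then show ?thesis
    by (simp add: mode1_diff mode_commute norm_unfold3 flip: unfold3_mode3 unfold3_diff)
qed

section \<open>Error of the iteration\<close>

text \<open>Eliminating \<open>u\<close> gives v(t+1) \<le> g + XY v(t) with g = \<alpha> + X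
  \<beta>. The constant 101/100 is preserved because 1 + 1.01 * 0.009 \<le> 1.01.\<close>

lemma alternating_recursion:
  fixes u v :: "nat \<Rightarrow> real"
  assumes nonneg: "0 \<le> X" "0 \<le> Y" "0 \<le> \<alpha>" "0 \<le> \<beta>" and \<rho>: "X * Y \<le> 9 / 1000"
    and u0: "u 0 \<le> w" and v: "\<And>t. t \<le> T \<Longrightarrow> v t \<le> \<alpha> + X * u t"
    and u: "\<And>t. t < T \<Longrightarrow> u (Suc t) \<le> \<beta> + Y * v t"
    and t: "t \<le> T"
  shows "v t \<le> 101 / 100 * (\<alpha> + X * \<beta>) + (X * Y) ^ t * (X * w)"
  using t
proof (induction t)
  case 0
  have "X * u 0 \<le> X * w" using u0 nonneg by (intro mult_left_mono)
  moreover have "\<alpha> \<le> 101 / 100 * (\<alpha> + X * \<beta>)"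
    using mult_nonneg_nonneg[OF nonneg(1,4)] nonneg(3) by (simp add: distrib_left)
  ultimately show ?case using v[of 0] unfolding power_0 by linarith
next
  case (Suc t)
  define g where "g = \<alpha> + X * \<beta>"
  have g: "0 \<le> g" using nonneg by (simp add: g_def)
  have IH: "v t \<le> 101 / 100 * g + (X * Y) ^ t * (X * w)" using Suc by (simp add: g_def)
  have "v (Suc t) \<le> \<alpha> + X * u (Suc t)" using v Suc.prems by simp
  also have "\<dots> \<le> \<alpha> + X * (\<beta> + Y * v t)"
    using u[of t] Suc.prems nonneg by (simp add: mult_left_mono)
  also have "\<dots> = g + (X * Y) * v t" by (simp add: g_def algebra_simps)
  also have "\<dots> \<le> g + (X * Y) * (101 / 100 * g + (X * Y) ^ t * (X * w))"
    using IH nonneg by (intro add_left_mono mult_left_mono) auto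
  also have "\<dots> = g + 101 / 100 * ((X * Y) * g) + (X * Y) ^ Suc t * (X * w)"
    by (simp add: algebra_simps)
  also have "\<dots> \<le> 101 / 100 * g + (X * Y) ^ Suc t * (X * w)"
    using mult_right_mono[OF \<rho> g] g by linarith
  finally show ?case by (simp add: g_def)
qed

text \<open>The purely numerical end of the argument, with p = sqrt J, q = sqrt K, \<open>e\<close>
  the norm of the unfolded noise, and \<open>v\<close> the sine of the second factor one round
  before the last. The number of iterations is \<open>Suc n\<close>.\<close>

lemma combine_bounds:
  fixes S R a A bU bV e p q v :: real and n :: nat
  defines "X \<equiv> 203 / 100 * bV / R" and "Y \<equiv> 203 / 100 * bU / S"
    and "\<alpha> \<equiv> 203 / 100 * A / R" and "\<beta> \<equiv> 203 / 100 * a / S" and "w \<equiv> 2 * e / S"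
  assumes pos: "0 < S" "0 < R" and nonneg: "0 \<le> a" "0 \<le> A" "0 \<le> bU" "0 \<le> bV" "0 \<le> e" "0 \<le> p" "0 \<le> q"
    and small: "24 * bU \<le> S" "24 * bV \<le> R"
    and v: "v \<le> 101 / 100 * (\<alpha> + X * \<beta>) + (X * Y) ^ n * (X * w)"
  shows "253 / 100 * (p * (a + bU * v))
      + 5 / 2 * (q * A + q * bV * (\<beta> + Y * (101 / 100 * (\<alpha> + X * \<beta>))) + p * bU * ((X * Y) ^ Suc n * w))
    \<le> 4 * q * A + 4 * p * a + 48 * (q * bV * a / S + p * bU * A / R)
      + 3 * (p + q) * (64 * bV * bU / (S * R)) ^ Suc n * e"
proof -
  define x where "x = bV / R"
  define y where "y = bU / S"
  define m where "m = bU * A / R"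
  define l where "l = bV * a / S"
  define \<rho> where "\<rho> = X * Y"
  define P where "P = \<rho> ^ Suc n * e"
  have x: "0 \<le> x" "x \<le> 1 / 24" and y: "0 \<le> y" "y \<le> 1 / 24"
    using pos nonneg small by (simp_all add: x_def y_def field_simps)
  have m: "0 \<le> m" and l: "0 \<le> l" using pos nonneg by (simp_all add: m_def l_def)
  have xy: "0 \<le> x * y" "x * y \<le> 1 / 24 * (1 / 24)"
    using x y mult_mono[OF x(2) y(2)] by simp_all
  have \<rho>_xy: "\<rho> = (203 / 100)\<^sup>2 * (x * y)"
    by (simp add: \<rho>_def X_def Y_def x_def y_def power2_eq_square)
  \<comment> \<open>2.03^2 / 576 is about 0.00715, and 2.03^2 is below 64.\<close>
  have \<rho>: "0 \<le> \<rho>" "\<rho> \<le> 72 / 10000" "\<rho> \<le> 64 * (x * y)"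
    using xy by (simp_all add: \<rho>_xy power2_eq_square)
  have P: "0 \<le> P" using \<rho> nonneg by (simp add: P_def)
  have \<rho>a: "\<rho> * a \<le> 72 / 10000 * a" and \<rho>A: "\<rho> * A \<le> 72 / 10000 * A" and \<rho>l: "\<rho> * l \<le> 72 / 10000 * l"
    using \<rho> nonneg l by (intro mult_right_mono; simp)+
  have "bU * v \<le> bU * (101 / 100 * (\<alpha> + X * \<beta>) + \<rho> ^ n * (X * w))"
    using v nonneg by (intro mult_left_mono) (simp_all add: \<rho>_def)
  \<comment> \<open>The product bU X w equals (200/203) \<rho> e, which supplies the missing power
    of \<rho>: n rounds of contraction become \<open>Suc n\<close>.\<close>
  also have "\<dots> = 101 / 100 * (203 / 100 * m + \<rho> * a) + 200 / 203 * P"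
    using pos by (simp add: \<rho>_def X_def Y_def \<alpha>_def \<beta>_def w_def m_def P_def field_simps)
  finally have I1: "a + bU * v \<le> 102 / 100 * a + 21 / 10 * m + P"
    using \<rho>a P m nonneg by argo
  have "bV * (\<beta> + Y * (101 / 100 * (\<alpha> + X * \<beta>))) = 203 / 100 * l + 101 / 100 * (\<rho> * A + 203 / 100 * (\<rho> * l))"
    using pos by (simp add: \<rho>_def X_def Y_def \<alpha>_def \<beta>_def l_def field_simps)
  then have I2: "A + bV * (\<beta> + Y * (101 / 100 * (\<alpha> + X * \<beta>))) \<le> 102 / 100 * A + 21 / 10 * l"
    using \<rho>A \<rho>l l nonneg by argo
  \<comment> \<open>The ratio bU/S \<le> 1/24 makes this contribution small. Altogether p P receives
    2.53 + 2.5/12 < 3, which is the factor 3 of the remainder.\<close>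
  have "bU * (\<rho> ^ Suc n * w) = 2 * y * P"
    using pos by (simp add: w_def y_def P_def field_simps)
  also have "\<dots> \<le> 2 * (1 / 24) * P" using y P by (intro mult_right_mono) auto
  finally have I3: "bU * (\<rho> ^ Suc n * w) \<le> P / 12" by simp
  have "\<rho> ^ Suc n \<le> (64 * (x * y)) ^ Suc n" using \<rho> by (intro power_mono) auto
  then have L: "P \<le> (64 * bV * bU / (S * R)) ^ Suc n * e"
    unfolding P_def using nonneg by (intro mult_right_mono) (simp_all add: x_def y_def mult_ac)
  have J1: "p * (a + bU * v) \<le> 102 / 100 * (p * a) + 21 / 10 * (p * m) + p * P"
    using mult_left_mono[OF I1 nonneg(6)] by (simp add: algebra_simps)
  have J2: "q * A + q * bV * (\<beta> + Y * (101 / 100 * (\<alpha> + X * \<beta>))) \<le> 102 / 100 * (q * A) + 21 / 10 * (q * l)"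
    using mult_left_mono[OF I2 nonneg(7)] by (simp add: algebra_simps)
  have J3: "p * bU * (\<rho> ^ Suc n * w) \<le> p * P / 12"
    using mult_left_mono[OF I3 nonneg(6)] by (simp add: mult_ac)
  have J4: "3 * (p + q) * P \<le> 3 * (p + q) * (64 * bV * bU / (S * R)) ^ Suc n * e"
    using mult_left_mono[OF L, of "3 * (p + q)"] nonneg by (simp add: mult.assoc)
  have J5: "0 \<le> p * a" "0 \<le> p * m" "0 \<le> p * P" "0 \<le> q * A" "0 \<le> q * l" "0 \<le> q * P"
    using nonneg m l P by simp_all
  have J6: "48 * (q * bV * a / S + p * bU * A / R) = 48 * (q * l) + 48 * (p * m)"
    by (simp add: l_def m_def)
  have linear: "253 / 100 * t1 + 5 / 2 * (t2 + t3) \<le> 4 * (q * A) + 4 * (p * a) + 48 * (q * l) + 48 * (p * m) + 3 * (p * P + q * P)"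
    if "t1 \<le> 102 / 100 * (p * a) + 21 / 10 * (p * m) + p * P"
      "t2 \<le> 102 / 100 * (q * A) + 21 / 10 * (q * l)" "t3 \<le> p * P / 12" for t1 t2 t3
    using that J5 by argo
  have "253 / 100 * (p * (a + bU * v))
      + 5 / 2 * (q * A + q * bV * (\<beta> + Y * (101 / 100 * (\<alpha> + X * \<beta>))) + p * bU * (\<rho> ^ Suc n * w))
    \<le> 4 * (q * A) + 4 * (p * a) + 48 * (q * l) + 48 * (p * m) + 3 * (p + q) * P"
    using linear[OF J1 J2 J3] by (simp add: distrib_right mult.assoc)
  then show ?thesis using J4 J6 unfolding \<rho>_def by (simp add: mult.assoc)
qed

text \<open>With P, Q the projections onto the ranges of \<open>U\<close>, \<open>V\<close>, the
  signal part PQT - T is split as -(T - PT) - P(T - QT). The projection kept in the second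
  difference is the compression under which \<open>V\<close> was computed.\<close>

lemma hardtth_out_error:
  fixes U :: "real^'j::finite^'a::finite" and V :: "real^'k::finite^'c::finite"
  assumes U: "U \<in> orth_cols" and V: "V \<in> orth_cols"
  shows "norm (hardtth_out (Ts + E) U V - Ts) \<le> norm (mode1 (transpose U) (mode3 (transpose V) E))
    + norm (Ts - mode1 (U ** transpose U) Ts) + norm (mode1 (transpose U) (Ts - mode3 (V ** transpose V) Ts))"
proof -
  let ?N = "mode1 U (mode3 V (mode1 (transpose U) (mode3 (transpose V) E)))"
  let ?D = "mode1 U (mode1 (transpose U) (Ts - mode3 (V ** transpose V) Ts))"
  have "hardtth_out (Ts + E) U V - Ts = ?N - (Ts - mode1 (U ** transpose U) Ts) - ?D"
    by (simp add: hardtth_out_def mode1_add mode3_add mode1_diff mode_commute mode1_mode1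
        flip: mode1_mode1 mode3_mode3)
  also have "norm \<dots> \<le> norm ?N + norm (Ts - mode1 (U ** transpose U) Ts) + norm ?D"
    by (meson add_right_mono norm_triangle_ineq4 order_trans)
  finally show ?thesis by (simp add: norm_mode1_orth norm_mode3_orth U V)
qed

lemma hardtth_iterD:
  assumes "hardtth_iter Y T Uh Vh"
  shows "lead_left (unfold1 Y) (Uh 0)"
    and "t < T \<Longrightarrow> lead_left (unfold1 (mode3 (transpose (Vh t)) Y)) (Uh (Suc t))"
    and "t \<le> T \<Longrightarrow> lead_left (unfold3 (mode1 (transpose (Uh t)) Y)) (Vh t)"
proof -
  show "lead_left (unfold1 Y) (Uh 0)"
    using assms unfolding hardtth_iter_def by blast
  show "lead_left (unfold1 (mode3 (transpose (Vh t)) Y)) (Uh (Suc t))" if "t < T"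
    using assms that unfolding hardtth_iter_def by (metis Suc_leI diff_Suc_1 le_add1 plus_1_eq_Suc)
  show "lead_left (unfold3 (mode1 (transpose (Uh t)) Y)) (Vh t)" if "t \<le> T"
    using assms that unfolding hardtth_iter_def by (cases "t = 0") auto
qed

lemma hardtth_error_bound:
  fixes Us :: "real^'j::finite^'a::finite" and Vs :: "real^'k::finite^'c::finite"
    and Ts E :: "('a,'b::finite,'c) tensor"
    and Uh :: "nat \<Rightarrow> real^'j^'a" and Vh :: "nat \<Rightarrow> real^'k^'c"
  assumes leJ: "CARD('j) \<le> CARD('a)" and leK: "CARD('k) \<le> CARD('c)"
    and Us: "Us \<in> orth_cols" and Vs: "Vs \<in> orth_cols"
    and T1: "mode1 (Us ** transpose Us) Ts = Ts" and T3: "mode3 (Vs ** transpose Vs) Ts = Ts"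
    and iter: "hardtth_iter (Ts + E) (Suc n) Uh Vh"
  defines "S \<equiv> sing_val (unfold1 Ts) CARD('j)" and "R \<equiv> sing_val (unfold3 Ts) CARD('k)"
    and "e \<equiv> spec_norm (unfold1 E)"
    and "aU \<equiv> spec_norm (unfold1 (mode3 (transpose Vs) E))"
    and "aV \<equiv> spec_norm (unfold3 (mode1 (transpose Us) E))"
  assumes S: "0 < S" "24 * e \<le> S" and R: "0 < R" "24 * bV \<le> R"
    and bU: "\<And>V::real^'k^'c. spec_norm V \<le> 1 \<Longrightarrow> spec_norm (unfold1 (mode3 (transpose V) E)) \<le> bU"
    and bU_le: "bU \<le> e"
    and bV: "\<And>U::real^'j^'a. spec_norm U \<le> 1 \<Longrightarrow> spec_norm (unfold3 (mode1 (transpose U) E)) \<le> bV"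
    and \<Phi>: "\<And>(U::real^'j^'a) (V::real^'k^'c). U \<in> orth_cols \<Longrightarrow> V \<in> orth_cols \<Longrightarrow>
      norm (mode1 (transpose U) (mode3 (transpose V) E)) \<le> \<Phi>"
  shows "norm (hardtth_out (Ts + E) (Uh (Suc n)) (Vh (Suc n)) - Ts)
    \<le> \<Phi> + 4 * sqrt (real CARD('k)) * aV + 4 * sqrt (real CARD('j)) * aU
      + 48 * (sqrt (real CARD('k)) * bV * aU / S + sqrt (real CARD('j)) * bU * aV / R)
      + 3 * (sqrt (real CARD('j)) + sqrt (real CARD('k))) * (64 * bV * bU / (S * R)) ^ Suc n * e"
proof -
  let ?J = "sqrt (real CARD('j))" and ?K = "sqrt (real CARD('k))"
  define u where "u t = sin_theta Us (Uh t)" for t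
  define v where "v t = sin_theta Vs (Vh t)" for t
  have Ulead: "t < Suc n \<Longrightarrow> lead_left (unfold1 (mode3 (transpose (Vh t)) (Ts + E))) (Uh (Suc t))"
    and Vlead: "t \<le> Suc n \<Longrightarrow> lead_left (unfold3 (mode1 (transpose (Uh t)) (Ts + E))) (Vh t)" for t
    using hardtth_iterD[OF iter] by blast+
  have Uo: "Uh t \<in> orth_cols" if "t \<le> Suc n" for t
  proof (cases t)
    case 0
    then show ?thesis using lead_left_orth[OF hardtth_iterD(1)[OF iter] leJ] by simp
  next
    case (Suc r)
    then show ?thesis using lead_left_orth[OF Ulead[of r] leJ] that by simp
  qed
  have Vo: "Vh t \<in> orth_cols" if "t \<le> Suc n" for t
    using that lead_left_orth[OF _ leK] Vlead by blast
  have bU0: "0 \<le> bU" using bU[OF orth_cols_spec[OF Vs]] spec_norm_nonneg order_trans by blast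
  have bV0: "0 \<le> bV" using bV[OF orth_cols_spec[OF Us]] spec_norm_nonneg order_trans by blast
  have nonneg: "0 \<le> aU" "0 \<le> aV" "0 \<le> e" by (simp_all add: aU_def aV_def e_def spec_norm_nonneg)
  have small: "24 * bU \<le> S" using bU_le S by linarith
  \<comment> \<open>A sine of at most 1/10 admits the cosine bound 99/100, since 0.9801 + 0.01 \<le>
    1.\<close>
  have sq: "(99 / 100 :: real)\<^sup>2 + s\<^sup>2 \<le> 1" if "0 \<le> s" "s \<le> 1 / 10" for s :: real
    using power_mono[OF that(2,1), of 2] by (simp add: power2_eq_square)
  have S_u0: "S * u 0 \<le> 2 * e"
    unfolding u_def S_def e_def
  proof (rule sin_theta_perturbation[OF leJ])
    show T1': "Us ** transpose Us ** unfold1 Ts = unfold1 Ts" by (simp add: T1 flip: unfold1_mode1)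
    show "lead_left (unfold1 Ts + unfold1 E) (Uh 0)"
      using hardtth_iterD(1)[OF iter] by (simp add: unfold1_add)
    show "0 < sing_val (unfold1 Ts) CARD('j)" using S S_def by simp
    show "sing_val (unfold1 Ts) CARD('j) * norm y \<le> norm (transpose (unfold1 Ts) *v (Us *v y))" for y
      by (rule sing_val_le[OF leJ Us T1'])
  qed
  have V_step: "v t \<le> 1 / 10 \<and> R * v t \<le> 203 / 100 * (aV + bV * u t)"
    if t: "t \<le> Suc n" and ut: "u t \<le> 1 / 10" for t
  proof -
    let ?z = "spec_norm (unfold3 (mode1 (transpose (Uh t)) E))"
    have "99 / 100 * R * v t \<le> 2 * ?z"
      unfolding R_def v_def
      by (rule mode3_update_sin_theta[OF leK Us Vs Uo[OF t] T1 T3])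
         (use t ut R Vlead[OF t] sq[OF sin_theta_nonneg] in \<open>simp_all add: u_def R_def\<close>)
    moreover have "?z \<le> bV" by (rule bV[OF orth_cols_spec[OF Uo[OF t]]])
    moreover have "?z \<le> aV + bV * u t"
    proof -
      have "?z \<le> aV + bV * sin_theta (Uh t) Us"
        unfolding aV_def by (rule noise_unfold3[OF Uo[OF t] Us bV])
      also have "\<dots> \<le> aV + bV * u t"
        using bV0 ut sin_theta_commute_le[OF Us Uo[OF t]] by (simp add: u_def mult_left_mono)
      finally show ?thesis .
    qed
    moreover have "0 \<le> aV + bV * u t" using nonneg bV0 by (simp add: u_def sin_theta_nonneg)
    \<comment> \<open>The crude noise bound \<open>bV\<close> gives 2/(24 * 0.99) < 1/10, which
      keeps the induction alive; the refined one gives the recursion, with 2/0.99 < 203/100.\<close>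
    ultimately have "R * v t \<le> R * (1 / 10) \<and> R * v t \<le> 203 / 100 * (aV + bV * u t)"
      using R by argo
    then show ?thesis using R by (auto simp: mult_le_cancel_left_pos)
  qed
  have U_step: "u (Suc t) \<le> 1 / 10 \<and> S * u (Suc t) \<le> 203 / 100 * (aU + bU * v t)"
    if t: "t < Suc n" and vt: "v t \<le> 1 / 10" for t
  proof -
    let ?z = "spec_norm (unfold1 (mode3 (transpose (Vh t)) E))"
    have V: "Vh t \<in> orth_cols" using Vo t by simp
    have "99 / 100 * S * u (Suc t) \<le> 2 * ?z"
      unfolding S_def u_def
      by (rule mode1_update_sin_theta[OF leJ Us Vs V T1 T3])
         (use vt S Ulead[OF t] sq[OF sin_theta_nonneg] in \<open>simp_all add: v_def S_def\<close>)
    moreover have "?z \<le> bU" by (rule bU[OF orth_cols_spec[OF V]])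
    moreover have "?z \<le> aU + bU * v t"
    proof -
      have "?z \<le> aU + bU * sin_theta (Vh t) Vs"
        unfolding aU_def by (rule noise_unfold1[OF V Vs bU])
      also have "\<dots> \<le> aU + bU * v t"
        using bU0 vt sin_theta_commute_le[OF Vs V] by (simp add: v_def mult_left_mono)
      finally show ?thesis .
    qed
    moreover have "0 \<le> aU + bU * v t" using nonneg bU0 by (simp add: v_def sin_theta_nonneg)
    ultimately have "S * u (Suc t) \<le> S * (1 / 10) \<and> S * u (Suc t) \<le> 203 / 100 * (aU + bU * v t)"
      using S small by argo
    then show ?thesis using S by (auto simp: mult_le_cancel_left_pos)
  qed
  have u_small: "u t \<le> 1 / 10" if "t \<le> Suc n" for t
    using that
  proof (induction t)
    case 0
    \<comment> \<open>The initial sine is at most 2/24.\<close>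
    have "S * u 0 \<le> S * (1 / 10)" using S_u0 S nonneg by linarith
    then show ?case using S by (simp add: mult_le_cancel_left_pos)
  next
    case (Suc t)
    then show ?case using U_step V_step by simp
  qed
  define X where "X = 203 / 100 * bV / R"
  define Y where "Y = 203 / 100 * bU / S"
  define \<alpha> where "\<alpha> = 203 / 100 * aV / R"
  define \<beta> where "\<beta> = 203 / 100 * aU / S"
  define w where "w = 2 * e / S"
  define G where "G = 101 / 100 * (\<alpha> + X * \<beta>)"
  have XY: "0 \<le> X" "X \<le> 203 / 2400" "0 \<le> Y" "Y \<le> 203 / 2400" "0 \<le> \<alpha>" "0 \<le> \<beta>" "0 \<le> w"
    using S R bU0 bV0 small nonneg
    by (simp_all add: X_def Y_def \<alpha>_def \<beta>_def w_def field_simps)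
  have G0: "0 \<le> G" using XY by (simp add: G_def)
  have \<rho>: "X * Y \<le> 9 / 1000"
    using mult_mono[OF XY(2,4)] XY by simp
  have u_rec: "u (Suc t) \<le> \<beta> + Y * v t" if "t < Suc n" for t
    using U_step[OF that] V_step u_small that S by (simp add: \<beta>_def Y_def field_simps)
  have v_bound: "v n \<le> G + (X * Y) ^ n * (X * w)"
    unfolding G_def
  proof (rule alternating_recursion[where u = u and T = n, OF XY(1,3,5,6) \<rho>])
    show "u 0 \<le> w" using S_u0 S by (simp add: w_def field_simps)
    show "v t \<le> \<alpha> + X * u t" if "t \<le> n" for t
      using V_step[of t] u_small[of t] that R by (simp add: \<alpha>_def X_def field_simps)
    show "u (Suc t) \<le> \<beta> + Y * v t" if "t < n" for t using u_rec that by simp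
  qed simp
  let ?U = "Uh (Suc n)" and ?V = "Vh (Suc n)"
  have Uo': "?U \<in> orth_cols" and Vo': "?V \<in> orth_cols" and Vn: "Vh n \<in> orth_cols"
    using Uo Vo by simp_all
  have "u (Suc n) \<le> \<beta> + Y * (G + (X * Y) ^ n * (X * w))"
    using u_rec[of n] mult_left_mono[OF v_bound XY(3)] by simp
  \<comment> \<open>The grouping matters: the first bracket will be charged to sqrt K
    \<open>bV\<close>, the initialisation error to sqrt J \<open>bU\<close>.\<close>
  also have "\<dots> = (\<beta> + Y * G) + (X * Y) ^ Suc n * w" by (simp add: algebra_simps)
  finally have u_final: "u (Suc n) \<le> (\<beta> + Y * G) + (X * Y) ^ Suc n * w" .
  have E1: "norm (Ts - mode1 (?U ** transpose ?U) Ts) \<le> 253 / 100 * (?J * (aU + bU * v n))"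
  proof -
    let ?D = "Ts - mode1 (?U ** transpose ?U) Ts"
    let ?z = "spec_norm (unfold1 (mode3 (transpose (Vh n)) E))"
    have vn: "v n \<le> 1 / 10" using V_step[of n] u_small[of n] by simp
    have "?z \<le> aU + bU * sin_theta (Vh n) Vs"
      unfolding aU_def by (rule noise_unfold1[OF Vn Vs bU])
    also have "\<dots> \<le> aU + bU * v n"
      using bU0 vn sin_theta_commute_le[OF Vs Vn] by (simp add: v_def mult_left_mono)
    finally have z: "?J * ?z \<le> ?J * (aU + bU * v n)" by (rule mult_left_mono) simp
    \<comment> \<open>The last \<open>U\<close> was computed from the tensor compressed by
      \<open>Vh n\<close>, so that compression has to be undone; this costs 1/0.99 and turns 5/2
      into 253/100.\<close>
    have "99 / 100 * norm ?D \<le> norm (mode3 (transpose (Vh n)) ?D)"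
    proof (rule mode3_lower_bound[OF _ Vs])
      show "mode3 (Vs ** transpose Vs) ?D = ?D" by (simp add: mode3_diff mode_commute T3)
      show "99 / 100 * norm y \<le> norm (transpose (Vh n) *v (Vs *v y))" for y
        using vn by (intro sin_theta_cos[OF Vs Vn] sq sin_theta_nonneg) (simp add: v_def)
    qed simp
    also have "\<dots> \<le> 5 / 2 * (?J * ?z)"
      by (rule mode1_update_frobenius[OF leJ Us T1]) (auto intro: Ulead norm_mode1_orth_transpose_le)
    finally have "99 / 100 * norm ?D \<le> 5 / 2 * (?J * (aU + bU * v n))" using z by linarith
    moreover have "0 \<le> ?J * (aU + bU * v n)"
      using nonneg bU0 by (simp add: v_def sin_theta_nonneg)
    ultimately show ?thesis by linarith
  qed
  \<comment> \<open>No factor 1/0.99 here: the quantity is already compressed by the same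
    \<open>U\<close> from which \<open>V\<close> was computed.\<close>
  have E2: "norm (mode1 (transpose ?U) (Ts - mode3 (?V ** transpose ?V) Ts))
      \<le> 5 / 2 * (?K * aV + ?K * bV * (\<beta> + Y * G) + ?J * bU * ((X * Y) ^ Suc n * w))"
  proof (rule mode3_update_frobenius[OF leK Vs T3])
    show "lead_left (unfold3 (mode1 (transpose ?U) (Ts + E))) ?V" by (rule Vlead) simp
    fix V :: "real^'k^'c"
    assume V: "V \<in> orth_cols"
    show "norm (mode3 (transpose V) (mode1 (transpose ?U) E))
        \<le> ?K * aV + ?K * bV * (\<beta> + Y * G) + ?J * bU * ((X * Y) ^ Suc n * w)"
      unfolding aV_def
    proof (rule noise_frobenius[OF Uo' Us V bU bV])
      have "sin_theta ?U Us \<le> u (Suc n)"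
        unfolding u_def using u_small[of "Suc n"] by (intro sin_theta_commute_le Us Uo') (simp add: u_def)
      then show "sin_theta ?U Us \<le> (\<beta> + Y * G) + (X * Y) ^ Suc n * w" using u_final by linarith
    qed (use XY G0 in auto)
  qed
  have "norm (hardtth_out (Ts + E) ?U ?V - Ts) \<le> \<Phi>
      + (253 / 100 * (?J * (aU + bU * v n))
      + 5 / 2 * (?K * aV + ?K * bV * (\<beta> + Y * G) + ?J * bU * ((X * Y) ^ Suc n * w)))"
    using hardtth_out_error[OF Uo' Vo', of Ts E] \<Phi>[OF Uo' Vo'] E1 E2 by linarith
  also have "\<dots> \<le> \<Phi> + (4 * ?K * aV + 4 * ?J * aU + 48 * (?K * bV * aU / S + ?J * bU * aV / R)
      + 3 * (?J + ?K) * (64 * bV * bU / (S * R)) ^ Suc n * e)"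
    unfolding X_def Y_def \<alpha>_def \<beta>_def w_def G_def
    by (intro add_left_mono combine_bounds S(1) R(1) nonneg bU0 bV0 small R(2)
        v_bound[unfolded X_def Y_def \<alpha>_def \<beta>_def w_def G_def]) simp_all
  finally show ?thesis by simp
qed

text \<open>For the degenerate case of a vanishing singular value. Without noise the Frobenius
  perturbation bound is 0, so every iterate reproduces the true tensor, whatever its singular
  values.\<close>

lemma hardtth_exact_recovery:
  fixes Us :: "real^'j::finite^'a::finite" and Vs :: "real^'k::finite^'c::finite"
    and Ts :: "('a,'b::finite,'c) tensor"
    and Uh :: "nat \<Rightarrow> real^'j^'a" and Vh :: "nat \<Rightarrow> real^'k^'c"
  assumes leJ: "CARD('j) \<le> CARD('a)" and leK: "CARD('k) \<le> CARD('c)"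
    and Us: "Us \<in> orth_cols" and Vs: "Vs \<in> orth_cols"
    and T1: "mode1 (Us ** transpose Us) Ts = Ts" and T3: "mode3 (Vs ** transpose Vs) Ts = Ts"
    and iter: "hardtth_iter Ts T Uh Vh"
  shows "hardtth_out Ts (Uh T) (Vh T) = Ts"
proof -
  have zero1: "mode1 A (0 :: ('m::finite,'b,'n::finite) tensor) = 0" for A :: "real^'m^'l::finite"
    by (simp add: mode1_def vec_eq_iff)
  have zero3: "mode3 A (0 :: ('m::finite,'b,'n::finite) tensor) = 0" for A :: "real^'n^'l::finite"
    by (simp add: mode3_def vec_eq_iff)
  have U0: "mode1 (Uh 0 ** transpose (Uh 0)) Ts = Ts"
  proof -
    have "norm (unfold1 Ts - Uh 0 ** transpose (Uh 0) ** unfold1 Ts) \<le> 5 / 2 * 0"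
      by (rule frobenius_perturbation[OF leJ Us, where Z = 0])
         (use T1 hardtth_iterD(1)[OF iter] in \<open>simp_all flip: unfold1_mode1\<close>)
    then show ?thesis by (simp flip: unfold1_mode1 add: unfold1_eq_iff)
  qed
  have V_step: "mode3 (Vh t ** transpose (Vh t)) Ts = Ts"
    if t: "t \<le> T" and U: "mode1 (Uh t ** transpose (Uh t)) Ts = Ts" for t
  proof -
    have "norm (mode1 (transpose (Uh t)) (Ts - mode3 (Vh t ** transpose (Vh t)) Ts)) \<le> 5 / 2 * 0"
      by (rule mode3_update_frobenius[OF leK Vs T3, where E = 0])
         (use hardtth_iterD(3)[OF iter t] in \<open>simp_all add: zero1 zero3\<close>)
    \<comment> \<open>Only the compressed residual is known to vanish. Multiplying back by
      \<open>Uh t\<close> recovers the full residual because \<open>U\<close> already reproduces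
      \<open>Ts\<close>.\<close>
    then have "mode1 (Uh t) (mode1 (transpose (Uh t)) (Ts - mode3 (Vh t ** transpose (Vh t)) Ts)) = 0"
      by (simp add: zero1)
    then show ?thesis using U by (simp add: mode1_mode1 mode1_diff flip: mode_commute)
  qed
  have U_step: "mode1 (Uh (Suc t) ** transpose (Uh (Suc t))) Ts = Ts"
    if t: "t < T" and V: "mode3 (Vh t ** transpose (Vh t)) Ts = Ts" for t
  proof -
    have "norm (mode3 (transpose (Vh t)) (Ts - mode1 (Uh (Suc t) ** transpose (Uh (Suc t))) Ts)) \<le> 5 / 2 * 0"
      by (rule mode1_update_frobenius[OF leJ Us T1, where E = 0])
         (use hardtth_iterD(2)[OF iter t] in \<open>simp_all add: zero1 zero3\<close>)
    then have "mode3 (Vh t) (mode3 (transpose (Vh t)) (Ts - mode1 (Uh (Suc t) ** transpose (Uh (Suc t))) Ts)) = 0"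
      by (simp add: zero3)
    then show ?thesis using V by (simp add: mode3_mode3 mode3_diff mode_commute)
  qed
  have "mode1 (Uh t ** transpose (Uh t)) Ts = Ts" if "t \<le> T" for t
    using that
  proof (induction t)
    case (Suc t)
    then show ?case using U_step[of t] V_step[of t] by simp
  qed (rule U0)
  then have "mode1 (Uh T ** transpose (Uh T)) Ts = Ts" by simp
  then show ?thesis using V_step[of T]
    by (simp add: hardtth_out_def flip: mode_commute) (simp add: mode1_mode1 mode3_mode3 mode_commute)
qed

section \<open>Vanishing noise and the final bound\<close>

lemma spec_norm_eq_0D: "spec_norm M = 0 \<Longrightarrow> M = 0"
  for M :: "real^'n::finite^'m::finite"
  using norm_mul_le_sqrt_card[of "mat 1 :: real^'m^'m" M] by simp


lemma mode1_all_zero: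
  fixes E :: "('a::finite,'b::finite,'c::finite) tensor"
  assumes "\<And>W::real^'a^'j::finite. mode1 W E = 0"
  shows "E = 0"
proof -
  have "E $ a = 0" for a
  proof -
    \<comment> \<open>All rows of this matrix select slice \<open>a\<close>, so any row index, here
      \<open>undefined\<close>, exhibits it.\<close>
    have "mode1 ((\<chi> i. axis a 1) :: real^'a^'j) E $ undefined = E $ a"
      by (simp add: mode1_def vec_eq_iff axis_def mult_delta_left)
    then show ?thesis using assms by (metis zero_index)
  qed
  then show ?thesis by (simp add: vec_eq_iff)
qed

theorem theorem2:
  fixes Us :: "real^'j::finite^'a::finite"
    and Vs :: "real^'k::finite^'c::finite"
    and Ws :: "('j,'b::finite,'k) tensor"
    and E :: "('a,'b,'c) tensor"
    and T :: nat
    and Uh :: "nat \<Rightarrow> real^'j^'a" and Vh :: "nat \<Rightarrow> real^'k^'c"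
  assumes "CARD('j) \<le> CARD('a)" and "CARD('k) \<le> CARD('c)" and "1 \<le> T"
    and "Us \<in> orth_cols" and "Vs \<in> orth_cols"
    and "hardtth_iter (mode1 Us (mode3 Vs Ws) + E) T Uh Vh"
    and "sing_val (unfold1 (mode1 Us (mode3 Vs Ws))) CARD('j) \<ge> 24 * spec_norm (unfold1 E)"
    and "sing_val (unfold3 (mode1 Us (mode3 Vs Ws))) CARD('k) \<ge>
           24 * (SUP U\<in>{U::real^'j^'a. spec_norm U \<le> 1}.
                   spec_norm (unfold3 E ** kron U (mat 1 :: real^'b^'b)))"
  shows "let Tst = mode1 Us (mode3 Vs Ws); Y = Tst + E;
             sJ = sing_val (unfold1 Tst) CARD('j); sK = sing_val (unfold3 Tst) CARD('k);
             J = real CARD('j); K = real CARD('k);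
             aU = spec_norm (unfold1 (mode3 (transpose Vs) E));
             bU = (SUP V\<in>{V::real^'k^'c. spec_norm V \<le> 1}. spec_norm (unfold1 (mode3 (transpose V) E)));
             aV = spec_norm (unfold3 (mode1 (transpose Us) E));
             bV = (SUP U\<in>{U::real^'j^'a. spec_norm U \<le> 1}. spec_norm (unfold3 (mode1 (transpose U) E)));
             D2 = 48 * (sqrt K * bV * aU / sJ + sqrt J * bU * aV / sK);
             rT = 3 * (sqrt J + sqrt K) * (64 * bV * bU / (sJ * sK)) ^ T * spec_norm (unfold1 E)
         in tfro (hardtth_out Y (Uh T) (Vh T) - Tst)
            \<le> (SUP UV\<in>{(U::real^'j^'a, V::real^'k^'c). U \<in> orth_cols \<and> V \<in> orth_cols}.
                   tfro (mode1 (transpose (fst UV)) (mode3 (transpose (snd UV)) E)))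
              + 4 * sqrt K * aV + 4 * sqrt J * aU + D2 + rT"
proof -
  note leJ = assms(1) and leK = assms(2) and Us = assms(4) and Vs = assms(5)
  define Ts where "Ts = mode1 Us (mode3 Vs Ws)"
  define S where "S = sing_val (unfold1 Ts) CARD('j)"
  define R where "R = sing_val (unfold3 Ts) CARD('k)"
  define e where "e = spec_norm (unfold1 E)"
  define aU where "aU = spec_norm (unfold1 (mode3 (transpose Vs) E))"
  define aV where "aV = spec_norm (unfold3 (mode1 (transpose Us) E))"
  define bU where "bU = (SUP V\<in>{V::real^'k^'c. spec_norm V \<le> 1}. spec_norm (unfold1 (mode3 (transpose V) E)))"
  define bV where "bV = (SUP U\<in>{U::real^'j^'a. spec_norm U \<le> 1}. spec_norm (unfold3 (mode1 (transpose U) E)))"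
  define \<Phi> where "\<Phi> = (SUP UV\<in>{(U::real^'j^'a, V::real^'k^'c). U \<in> orth_cols \<and> V \<in> orth_cols}.
                   norm (mode1 (transpose (fst UV)) (mode3 (transpose (snd UV)) E)))"
  have T1: "mode1 (Us ** transpose Us) Ts = Ts"
    using Us by (simp add: Ts_def mode1_mode1 orth_cols_def flip: matrix_mul_assoc)
  have T3: "mode3 (Vs ** transpose Vs) Ts = Ts"
    using Vs by (simp add: Ts_def mode_commute mode3_mode3 orth_cols_def flip: matrix_mul_assoc)
  have iter: "hardtth_iter (Ts + E) T Uh Vh" using assms(6) by (simp add: Ts_def)
  have eS: "24 * e \<le> S" using assms(7) by (simp add: Ts_def S_def e_def)
  have bR: "24 * bV \<le> R" using assms(8) by (simp add: Ts_def R_def bV_def unfold3_kron)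
  have bU_e: "spec_norm (unfold1 (mode3 (transpose V) E)) \<le> e" if "spec_norm V \<le> 1" for V :: "real^'k^'c"
    using order_trans[OF spec_unfold1_mode3 mult_right_mono[OF _ spec_norm_nonneg]] that
    by (metis e_def mult_1 spec_norm_transpose)
  have bU: "spec_norm (unfold1 (mode3 (transpose V) E)) \<le> bU" if "spec_norm V \<le> 1" for V :: "real^'k^'c"
    \<comment> \<open>An upper bound by the \<open>SUP\<close> requires a set bounded above;
      \<open>e\<close> serves as the bound.\<close>
    unfolding bU_def using that bU_e by (intro cSUP_upper bdd_aboveI2[where M = e]) auto
  have bU_le: "bU \<le> e"
    unfolding bU_def using orth_cols_spec[OF Vs] bU_e by (intro cSUP_least) auto
  have bV: "spec_norm (unfold3 (mode1 (transpose U) E)) \<le> bV" if "spec_norm U \<le> 1" for U :: "real^'j^'a"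
    unfolding bV_def
  proof (intro cSUP_upper bdd_aboveI2)
    fix U :: "real^'j^'a"
    assume "U \<in> {U. spec_norm U \<le> 1}"
    then have "spec_norm (transpose U) * spec_norm (unfold3 E) \<le> 1 * spec_norm (unfold3 E)"
      by (intro mult_right_mono spec_norm_nonneg) (simp add: spec_norm_transpose)
    then show "spec_norm (unfold3 (mode1 (transpose U) E)) \<le> spec_norm (unfold3 E)"
      using spec_unfold3_mode1[of "transpose U" E] by linarith
  qed (use that in simp)
  have \<Phi>: "norm (mode1 (transpose U) (mode3 (transpose V) E)) \<le> \<Phi>"
    if "U \<in> orth_cols" "V \<in> orth_cols" for U :: "real^'j^'a" and V :: "real^'k^'c"
  proof -
    let ?O = "{(U::real^'j^'a, V::real^'k^'c). U \<in> orth_cols \<and> V \<in> orth_cols}"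
    have bdd: "bdd_above ((\<lambda>UV. norm (mode1 (transpose (fst UV)) (mode3 (transpose (snd UV)) E)))
        ` ?O)"
    proof (intro bdd_aboveI2)
      fix UV :: "(real^'j^'a) \<times> (real^'k^'c)"
      assume UV: "UV \<in> {(U, V). U \<in> orth_cols \<and> V \<in> orth_cols}"
      have "norm (mode1 (transpose (fst UV)) (mode3 (transpose (snd UV)) E)) \<le> 1 * (1 * norm E)"
        using UV orth_cols_spec[of "fst UV"] orth_cols_spec[of "snd UV"]
        by (intro order_trans[OF norm_mode1_le] mult_mono order_trans[OF norm_mode3_le])
           (auto simp: spec_norm_transpose)
      then show "norm (mode1 (transpose (fst UV)) (mode3 (transpose (snd UV)) E)) \<le> norm E" by simp
    qed
    have "(U, V) \<in> ?O" using that by simp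
    from cSUP_upper[OF this bdd] show ?thesis by (simp add: \<Phi>_def)
  qed
  have nonneg: "0 \<le> aU" "0 \<le> aV" "0 \<le> e" by (simp_all add: aU_def aV_def e_def spec_norm_nonneg)
  have nonneg': "0 \<le> bU" "0 \<le> bV" "0 \<le> \<Phi>"
    using bU[OF orth_cols_spec[OF Vs]] bV[OF orth_cols_spec[OF Us]] \<Phi>[OF Us Vs]
      spec_norm_nonneg norm_ge_zero order_trans by blast+
  have SR: "0 \<le> S" "0 \<le> R" using eS bR nonneg nonneg' by linarith+
  have "norm (hardtth_out (Ts + E) (Uh T) (Vh T) - Ts)
    \<le> \<Phi> + 4 * sqrt (real CARD('k)) * aV + 4 * sqrt (real CARD('j)) * aU
      + 48 * (sqrt (real CARD('k)) * bV * aU / S + sqrt (real CARD('j)) * bU * aV / R)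
      + 3 * (sqrt (real CARD('j)) + sqrt (real CARD('k))) * (64 * bV * bU / (S * R)) ^ T * e"
    (is "_ \<le> ?rhs")
  proof (cases "0 < S \<and> 0 < R")
    case True
    obtain n where T: "T = Suc n" using assms(3) by (cases T) auto
    show ?thesis
      unfolding T S_def R_def e_def aU_def aV_def
      by (rule hardtth_error_bound[OF leJ leK Us Vs T1 T3])
         (use True iter eS bR bU bU_le bV \<Phi> in \<open>auto simp: T S_def R_def e_def\<close>)
  next
    case False
    \<comment> \<open>The hypotheses bound the noise by the singular value that vanishes: either the
      first unfolding of \<open>E\<close> is 0, or all compressions of \<open>E\<close> along mode 1
      are.\<close>
    have "E = 0"
    proof (cases "S = 0")
      case True
      then have "unfold1 E = 0" using eS nonneg by (intro spec_norm_eq_0D) (simp add: e_def)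
      then show ?thesis by (metis norm_eq_zero norm_unfold1)
    next
      case False
      with \<open>\<not> (0 < S \<and> 0 < R)\<close> SR have "bV = 0" using bR nonneg' by auto
      \<comment> \<open>\<open>bV\<close> controls only matrices with \<open>CARD('j)\<close> rows.
        Homogeneity extends this to all sizes of entries, and single slices of \<open>E\<close> are
        then reached by \<open>mode1_all_zero\<close>.\<close>
      have "mode1 W E = 0" for W :: "real^'a^'j"
      proof -
        have "spec_norm (unfold3 (mode1 W E)) \<le> 0"
          using unfold3_mode1_homogeneous[OF bV, of W] \<open>bV = 0\<close> by simp
        then have "unfold3 (mode1 W E) = 0" by (intro spec_norm_eq_0D antisym spec_norm_nonneg)
        then show ?thesis by (metis norm_eq_zero norm_unfold3)
      qed
      then show ?thesis by (rule mode1_all_zero)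
    qed
    then have "hardtth_out (Ts + E) (Uh T) (Vh T) = Ts"
      using hardtth_exact_recovery[OF leJ leK Us Vs T1 T3, of T Uh Vh] iter by simp
    moreover have "0 \<le> ?rhs" using nonneg nonneg' SR by simp
    ultimately show ?thesis by simp
  qed
  then show ?thesis
    by (simp add: Let_def tfro_eq_norm Ts_def S_def R_def e_def aU_def aV_def bU_def bV_def \<Phi>_def)
qed

end
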